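(* A PGAS program $(P,N)$ is robust if and only if it has no computation that is both in normal form and violating.
   Context: PGAS programs. Fix finite domains of values $D$, addresses $A$, queue identifiers $Q$ (each containing $0$) and a finite set of registers $\mathit{Reg}$ taking values in $D$. Expressions are built from constants in $D$, registers, and operators over $D$. Commands are: $r\leftarrow \mathtt{mem}[e]$ (load), $\mathtt{mem}[e]\leftarrow e'$ (store), $r\leftarrow e$ (assign), $\mathtt{assume}(e)$, $\mathtt{read}(e_{la},e_{r},e_{ra},e_{q})$, $\mathtt{write}(e_{la},e_{r},e_{ra},e_{q})$ and $\mathtt{barrier}$, where $e_r$ evaluates in $\{1,\dots,N\}$. A program code is a finite automaton $P=(C,\mathit{Cmd},I,c_0,C)$ with finite control states $C$, initial $c_0$, transitions $I\subseteq C\times\mathit{Cmd}\times C$. A PGAS program $(P,N)$ runs one process per rank in $\mathit{Ranks}=\{1,\dots,N\}$. Semantics. A state is $(sc,M,\mathcal P,\mathcal V)$ with $sc:\mathit{Ranks}\to C$, $M:\mathit{Ranks}\times(\mathit{Reg}\cup A)\to D$, FIFO queues $\mathcal P:\mathit{Ranks}\times Q\to(\mathit{Ranks}\times A\times\mathit{Ranks}\times A)^*$, $\mathcal V:\mathit{Ranks}\times Q\to(\mathit{Ranks}\times A\times D)^*$. Initially all processes are at $c_0$, memory/registers $0$, queues empty. Events are triples $(k,r,x)$ with kind $k\in\{\mathit{load},\mathit{store},\mathit{assign},\mathit{assume},\mathit{read},\mathit{write},\mathit{pop}_a,\mathit{pop}_b,\mathit{barrier}\}$, rank $r$, address $x\in(\mathit{Ranks}\times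 A)\cup\{\bot\}$. Expressions of process $r$ are evaluated ($\mathit{val}$) in $r$'s registers. If $sc(r)=c_1\xrightarrow{cmd}c_2\in I$, process $r$ moves to $c_2$ and: load $r'\leftarrow\mathtt{mem}[e]$ emits $(\mathit{load},r,(r,\mathit{val}(e)))$ and sets register $r'$ to $M(r,\mathit{val}(e))$; store emits $(\mathit{store},r,(r,\mathit{val}(e)))$ and sets $M(r,\mathit{val}(e)):=\mathit{val}(e')$; assign emits $(\mathit{assign},r,\bot)$; $\mathtt{assume}(e)$ requires $\mathit{val}(e)\neq 0$ and emits $(\mathit{assume},r,\bot)$; $\mathtt{write}$ emits $(\mathit{write},r,\bot)$ and appends $(r,\mathit{val}(e_{la}),\mathit{val}(e_r),\mathit{val}(e_{ra}))$ to $\mathcal P(r,\mathit{val}(e_q))$; $\mathtt{read}$ emits $(\mathit{read},r,\bot)$ and appends $(\mathit{val}(e_r),\mathit{val}(e_{ra}),r,\mathit{val}(e_{la}))$ to $\mathcal P(r,\mathit{val}(e_q))$. At any time, a head $(r_s,a_s,r_d,a_d)$ of $\mathcal P(r,q)$ may be removed, emitting $(\mathit{pop}_a,r,(r_s,a_s))$ and appending $(r_d,a_d,M(r_s,a_s))$ to $\mathcal V(r,q)$; a head $(r_d,a_d,v)$ of $\mathcal V(r,q)$ may be removed, emitting $(\mathit{pop}_b,r,(r_d,a_d))$ and setting $M(r_d,a_d):=v$. If every process has a barrier transition enabled, all take it simultaneously, emitting $(\mathit{barrier},1,\bot)\cdots(\mathit{barrier},N,\bot)$. Computations $\mathrm{C}(P,N)$: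 emitted event sequences of runs from the initial state to a state with all queues empty. Writes of an address: kinds $\mathit{store},\mathit{pop}_b$; reads: $\mathit{load},\mathit{pop}_a$. Happens-before of $\tau\in\mathrm C(P,N)$: $\mathit{po}\cup\mathit{cf}\cup\equiv$, where $\mathit{po}$ relates, per rank, consecutive events among that rank's events of kind other than $\mathit{pop}_a,\mathit{pop}_b$; $e_1\,\mathit{cf}\,e_2$ iff $e_1$ precedes $e_2$, both access the same address, at least one is a write, and no write to that address lies strictly between; $\equiv$ is the symmetric relation linking each $\mathit{read}$/$\mathit{write}$ event with the $\mathit{pop}_a$ event handling its queue entry and with the $\mathit{pop}_b$ event handling the entry produced by that $\mathit{pop}_a$ (and these pops with each other), and linking all barrier events of the same barrier step. $\tau$ is violating if its happens-before relation has a cycle not included in $\equiv$; $(P,N)$ is robust if no computation is violating. Write $\equiv^*$ for the reflexive-transitive closure and $a<_\sigma b$ if $a$ occurs strictly before $b$ in $\sigma$. Normal form. $\tau\in\mathrm C(P,N)$ is in normal form if $\tau=\tau_1\tau_2\tau_3\tau_4$ where every event of $\tau_2\tau_3\tau_4$ has kind $\mathit{pop}_a$ or $\mathit{pop}_b$, and for all events $a,b$ in $\tau_1$ whose kinds are not $\mathit{pop}_a,\mathit{pop}_b$ and all $a',b'$ in the same part $\tau_i$ ($i\in\{1,2,3,4\}$): if $a<_{\tau_1}b$, not $a\equiv^*b$, $a\equiv^*a'$ and $b\equiv^*b'$, then $a'<_{\tau_i}b'$. *)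

theory Defs
  imports Main
begin

text \<open>Values, addresses, queue identifiers and ranks are all natural numbers, so that the value of
  an expression over the value domain can be used directly as an address, a queue or a rank.\<close>

type_synonym rank = nat
type_synonym address = "rank \<times> nat"

subsection \<open>Programs\<close>

datatype 'r expr =
    Const nat
  | Rg 'r
  | Op "nat list \<Rightarrow> nat" "'r expr list"

primrec eval :: "('r \<Rightarrow> nat) \<Rightarrow> 'r expr \<Rightarrow> nat" where
  "eval \<rho> (Const v) = v"
| "eval \<rho> (Rg x) = \<rho> x"
| "eval \<rho> (Op f es) = f (map (eval \<rho>) es)"

inductive expr_over :: "nat set \<Rightarrow> 'r set \<Rightarrow> 'r expr \<Rightarrow> bool" for D :: "nat set" and Regs :: "'r set" where
  "v \<in> D \<Longrightarrow> expr_over D Regs (Const v)"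
| "x \<in> Regs \<Longrightarrow> expr_over D Regs (Rg x)"
| "(\<And>e. e \<in> set es \<Longrightarrow> expr_over D Regs e) \<Longrightarrow>
   (\<And>vs. set vs \<subseteq> D \<Longrightarrow> length vs = length es \<Longrightarrow> f vs \<in> D) \<Longrightarrow>
   expr_over D Regs (Op f es)"

text \<open>The operands of \<open>Read\<close> and \<open>Write\<close> are, in this order, the local address, the remote rank,
  the remote address and the queue.\<close>

datatype 'r cmd =
    Load 'r "'r expr"
  | Store "'r expr" "'r expr"
  | Assign 'r "'r expr"
  | Assume "'r expr"
  | Read "'r expr" "'r expr" "'r expr" "'r expr"
  | Write "'r expr" "'r expr" "'r expr" "'r expr"
  | Barrier

fun cmd_over :: "nat set \<Rightarrow> 'r set \<Rightarrow> 'r cmd \<Rightarrow> bool" where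
  "cmd_over D Regs (Load x e) \<longleftrightarrow> x \<in> Regs \<and> expr_over D Regs e"
| "cmd_over D Regs (Store e e') \<longleftrightarrow> expr_over D Regs e \<and> expr_over D Regs e'"
| "cmd_over D Regs (Assign x e) \<longleftrightarrow> x \<in> Regs \<and> expr_over D Regs e"
| "cmd_over D Regs (Assume e) \<longleftrightarrow> expr_over D Regs e"
| "cmd_over D Regs (Read la rr ra q) \<longleftrightarrow> (\<forall>e \<in> {la, rr, ra, q}. expr_over D Regs e)"
| "cmd_over D Regs (Write la rr ra q) \<longleftrightarrow> (\<forall>e \<in> {la, rr, ra, q}. expr_over D Regs e)"
| "cmd_over D Regs Barrier \<longleftrightarrow> True"

text \<open>All control states of a program code are final, so no set of final states is recorded.\<close>

record ('c, 'r) program_code =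
  ctrl :: "'c set"
  trans :: "('c \<times> 'r cmd \<times> 'c) set"
  init :: 'c

definition ranks :: "nat \<Rightarrow> rank set" where
  "ranks N = {1..N}"

subsection \<open>Semantics\<close>

datatype 'r loc = Reg 'r | Adr nat

text \<open>Every queue entry is preceded by a ghost identifier, naming the \<open>Read\<close> or \<open>Write\<close> that created
  it. Identifiers are copied along but never inspected, so erasing them yields the plain queues.\<close>

record ('c, 'r) state =
  sc :: "rank \<Rightarrow> 'c"
  mem :: "rank \<times> 'r loc \<Rightarrow> nat"
  pq :: "rank \<times> nat \<Rightarrow> (nat \<times> rank \<times> nat \<times> rank \<times> nat) list"
  vq :: "rank \<times> nat \<Rightarrow> (nat \<times> rank \<times> nat \<times> nat) list"

definition initial_state :: "('c, 'r) program_code \<Rightarrow> ('c, 'r) state" where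
  "initial_state P = \<lparr>sc = (\<lambda>_. init P), mem = (\<lambda>_. 0), pq = (\<lambda>_. []), vq = (\<lambda>_. [])\<rparr>"

definition queues_empty :: "('c, 'r) state \<Rightarrow> bool" where
  "queues_empty s \<longleftrightarrow> (\<forall>rq. pq s rq = [] \<and> vq s rq = [])"

definition val :: "('c, 'r) state \<Rightarrow> rank \<Rightarrow> 'r expr \<Rightarrow> nat" where
  "val s r e = eval (\<lambda>x. mem s (r, Reg x)) e"

datatype kind =
  KLoad | KStore | KAssign | KAssume | KRead | KWrite | KPopA | KPopB | KBarrier

type_synonym event = "kind \<times> rank \<times> address option"

text \<open>An event sequence alone does not say which \<open>KPopA\<close> and \<open>KPopB\<close> events handle which
  \<open>KRead\<close> or \<open>KWrite\<close> event, because events do not mention queues. Emitted events therefore carry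
  an identifier. In \<open>step P N n s es s'\<close> the number \<open>n\<close> is an identifier, chosen fresh in
  \<open>run\<close>. It is attached to the events of a program command and to all events of a barrier step,
  whereas pops emit the identifier of the entry they handle. The choice of fresh identifiers is
  irrelevant, as only their equality is ever used.\<close>

type_synonym tagged_event = "event \<times> nat"

inductive step :: "('c, 'r) program_code \<Rightarrow> nat \<Rightarrow> nat \<Rightarrow>
    ('c, 'r) state \<Rightarrow> tagged_event list \<Rightarrow> ('c, 'r) state \<Rightarrow> bool"
  for P :: "('c, 'r) program_code" and N n :: nat and s :: "('c, 'r) state" where
  load:
    "r \<in> ranks N \<Longrightarrow> (sc s r, Load x e, c) \<in> trans P \<Longrightarrow>
     step P N n s [((KLoad, r, Some (r, val s r e)), n)]
       (s\<lparr>sc := (sc s)(r := c),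
          mem := (mem s)((r, Reg x) := mem s (r, Adr (val s r e)))\<rparr>)"
| store:
    "r \<in> ranks N \<Longrightarrow> (sc s r, Store e e', c) \<in> trans P \<Longrightarrow>
     step P N n s [((KStore, r, Some (r, val s r e)), n)]
       (s\<lparr>sc := (sc s)(r := c),
          mem := (mem s)((r, Adr (val s r e)) := val s r e')\<rparr>)"
| assign:
    "r \<in> ranks N \<Longrightarrow> (sc s r, Assign x e, c) \<in> trans P \<Longrightarrow>
     step P N n s [((KAssign, r, None), n)]
       (s\<lparr>sc := (sc s)(r := c), mem := (mem s)((r, Reg x) := val s r e)\<rparr>)"
| assm:
    "r \<in> ranks N \<Longrightarrow> (sc s r, Assume e, c) \<in> trans P \<Longrightarrow> val s r e \<noteq> 0 \<Longrightarrow>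
     step P N n s [((KAssume, r, None), n)] (s\<lparr>sc := (sc s)(r := c)\<rparr>)"
| read:
    "r \<in> ranks N \<Longrightarrow> (sc s r, Read la rr ra q, c) \<in> trans P \<Longrightarrow>
     step P N n s [((KRead, r, None), n)]
       (s\<lparr>sc := (sc s)(r := c),
          pq := (pq s)((r, val s r q) :=
            pq s (r, val s r q) @ [(n, val s r rr, val s r ra, r, val s r la)])\<rparr>)"
| "write":
    "r \<in> ranks N \<Longrightarrow> (sc s r, Write la rr ra q, c) \<in> trans P \<Longrightarrow>
     step P N n s [((KWrite, r, None), n)]
       (s\<lparr>sc := (sc s)(r := c),
          pq := (pq s)((r, val s r q) :=
            pq s (r, val s r q) @ [(n, r, val s r la, val s r rr, val s r ra)])\<rparr>)"
| pop_a:
    "r \<in> ranks N \<Longrightarrow> pq s (r, q) = (i, rs, as, rd, ad) # es \<Longrightarrow>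
     step P N n s [((KPopA, r, Some (rs, as)), i)]
       (s\<lparr>pq := (pq s)((r, q) := es),
          vq := (vq s)((r, q) := vq s (r, q) @ [(i, rd, ad, mem s (rs, Adr as))])\<rparr>)"
| pop_b:
    "r \<in> ranks N \<Longrightarrow> vq s (r, q) = (i, rd, ad, v) # es \<Longrightarrow>
     step P N n s [((KPopB, r, Some (rd, ad)), i)]
       (s\<lparr>vq := (vq s)((r, q) := es), mem := (mem s)((rd, Adr ad) := v)\<rparr>)"
| barrier:
    "(\<And>r. r \<in> ranks N \<Longrightarrow> (sc s r, Barrier, c r) \<in> trans P) \<Longrightarrow>
     step P N n s (map (\<lambda>r. ((KBarrier, r, None), n)) [1..<Suc N])
       (s\<lparr>sc := (\<lambda>r. if r \<in> ranks N then c r else sc s r)\<rparr>)"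

inductive run :: "('c, 'r) program_code \<Rightarrow> nat \<Rightarrow> tagged_event list \<Rightarrow> ('c, 'r) state \<Rightarrow> bool"
  for P :: "('c, 'r) program_code" and N :: nat where
  start: "run P N [] (initial_state P)"
| extend: "run P N \<tau> s \<Longrightarrow> n \<notin> snd ` set \<tau> \<Longrightarrow> step P N n s es s' \<Longrightarrow> run P N (\<tau> @ es) s'"

definition computations :: "('c, 'r) program_code \<Rightarrow> nat \<Rightarrow> tagged_event list set" where
  "computations P N = {\<tau>. \<exists>s. run P N \<tau> s \<and> queues_empty s}"

subsection \<open>Well-formed PGAS programs\<close>

fun operands_in_range :: "nat set \<Rightarrow> nat set \<Rightarrow> nat \<Rightarrow> ('r expr \<Rightarrow> nat) \<Rightarrow> 'r cmd \<Rightarrow> bool" where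
  "operands_in_range A Q N ev (Load x e) \<longleftrightarrow> ev e \<in> A"
| "operands_in_range A Q N ev (Store e e') \<longleftrightarrow> ev e \<in> A"
| "operands_in_range A Q N ev (Read la rr ra q) \<longleftrightarrow>
     ev la \<in> A \<and> ev rr \<in> ranks N \<and> ev ra \<in> A \<and> ev q \<in> Q"
| "operands_in_range A Q N ev (Write la rr ra q) \<longleftrightarrow>
     ev la \<in> A \<and> ev rr \<in> ranks N \<and> ev ra \<in> A \<and> ev q \<in> Q"
| "operands_in_range A Q N ev _ \<longleftrightarrow> True"

text \<open>Operands used as addresses, queues and ranks are required to lie in the respective domains
  whenever they can actually be evaluated, rather than for all conceivable register contents.\<close>

definition pgas_program ::
  "nat set \<Rightarrow> nat set \<Rightarrow> nat set \<Rightarrow> 'r set \<Rightarrow> ('c, 'r) program_code \<Rightarrow> nat \<Rightarrow> bool" where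
  "pgas_program D A Q Regs P N \<longleftrightarrow>
     finite (ctrl P) \<and> init P \<in> ctrl P \<and> finite (trans P) \<and>
     trans P \<subseteq> ctrl P \<times> {cmd. cmd_over D Regs cmd} \<times> ctrl P \<and>
     (\<forall>\<tau> s r cmd c. run P N \<tau> s \<longrightarrow> r \<in> ranks N \<longrightarrow> (sc s r, cmd, c) \<in> trans P \<longrightarrow>
        operands_in_range A Q N (val s r) cmd)"

subsection \<open>Happens-before and robustness\<close>

text \<open>The relations below are on positions in the sequence, since they concern occurrences of
  events.\<close>

definition ev_kind :: "tagged_event list \<Rightarrow> nat \<Rightarrow> kind" where
  "ev_kind \<tau> i = fst (fst (\<tau> ! i))"

definition ev_rank :: "tagged_event list \<Rightarrow> nat \<Rightarrow> rank" where
  "ev_rank \<tau> i = fst (snd (fst (\<tau> ! i)))"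

definition ev_addr :: "tagged_event list \<Rightarrow> nat \<Rightarrow> address option" where
  "ev_addr \<tau> i = snd (snd (fst (\<tau> ! i)))"

definition ev_id :: "tagged_event list \<Rightarrow> nat \<Rightarrow> nat" where
  "ev_id \<tau> i = snd (\<tau> ! i)"

definition is_pop :: "tagged_event list \<Rightarrow> nat \<Rightarrow> bool" where
  "is_pop \<tau> i \<longleftrightarrow> ev_kind \<tau> i \<in> {KPopA, KPopB}"

definition is_write :: "tagged_event list \<Rightarrow> nat \<Rightarrow> bool" where
  "is_write \<tau> i \<longleftrightarrow> ev_kind \<tau> i \<in> {KStore, KPopB}"

definition po :: "tagged_event list \<Rightarrow> (nat \<times> nat) set" where
  "po \<tau> = {(i, j). i < j \<and> j < length \<tau> \<and> ev_rank \<tau> i = ev_rank \<tau> j \<and>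
     \<not> is_pop \<tau> i \<and> \<not> is_pop \<tau> j \<and>
     \<not> (\<exists>k. i < k \<and> k < j \<and> ev_rank \<tau> k = ev_rank \<tau> i \<and> \<not> is_pop \<tau> k)}"

definition cf :: "tagged_event list \<Rightarrow> (nat \<times> nat) set" where
  "cf \<tau> = {(i, j). i < j \<and> j < length \<tau> \<and>
     (\<exists>x. ev_addr \<tau> i = Some x \<and> ev_addr \<tau> j = Some x \<and>
       (is_write \<tau> i \<or> is_write \<tau> j) \<and>
       \<not> (\<exists>k. i < k \<and> k < j \<and> is_write \<tau> k \<and> ev_addr \<tau> k = Some x))}"

text \<open>Distinct events with equal identifiers are exactly a \<open>KRead\<close> or \<open>KWrite\<close> together with the
  pops handling its entry, or the events of one barrier step.\<close>

definition same_action :: "tagged_event list \<Rightarrow> (nat \<times> nat) set" where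
  "same_action \<tau> = {(i, j). i < length \<tau> \<and> j < length \<tau> \<and> i \<noteq> j \<and> ev_id \<tau> i = ev_id \<tau> j}"

definition happens_before :: "tagged_event list \<Rightarrow> (nat \<times> nat) set" where
  "happens_before \<tau> = po \<tau> \<union> cf \<tau> \<union> same_action \<tau>"

definition cycle_edges :: "'a list \<Rightarrow> ('a \<times> 'a) set" where
  "cycle_edges xs = set (zip xs (rotate1 xs))"

definition is_cycle :: "('a \<times> 'a) set \<Rightarrow> 'a list \<Rightarrow> bool" where
  "is_cycle R xs \<longleftrightarrow> xs \<noteq> [] \<and> cycle_edges xs \<subseteq> R"

definition violating :: "tagged_event list \<Rightarrow> bool" where
  "violating \<tau> \<longleftrightarrow>
     (\<exists>xs. is_cycle (happens_before \<tau>) xs \<and> \<not> cycle_edges xs \<subseteq> same_action \<tau>)"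

definition robust :: "('c, 'r) program_code \<Rightarrow> nat \<Rightarrow> bool" where
  "robust P N \<longleftrightarrow> (\<forall>\<tau> \<in> computations P N. \<not> violating \<tau>)"

subsection \<open>Normal form\<close>

text \<open>The four factors of the sequence are given by the cut points \<open>n1\<close>, \<open>n2\<close>, \<open>n3\<close>; they may be
  empty.\<close>

definition normal_form :: "tagged_event list \<Rightarrow> bool" where
  "normal_form \<tau> \<longleftrightarrow> (\<exists>n1 n2 n3. n1 \<le> n2 \<and> n2 \<le> n3 \<and> n3 \<le> length \<tau> \<and>
     (\<forall>i \<in> {n1..<length \<tau>}. is_pop \<tau> i) \<and>
     (\<forall>a \<in> {0..<n1}. \<forall>b \<in> {0..<n1}.
        \<not> is_pop \<tau> a \<longrightarrow> \<not> is_pop \<tau> b \<longrightarrow> a < b \<longrightarrow> (a, b) \<notin> (same_action \<tau>)\<^sup>* \<longrightarrow>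
        (\<forall>B \<in> {{0..<n1}, {n1..<n2}, {n2..<n3}, {n3..<length \<tau>}}. \<forall>a' \<in> B. \<forall>b' \<in> B.
           (a, a') \<in> (same_action \<tau>)\<^sup>* \<longrightarrow> (b, b') \<in> (same_action \<tau>)\<^sup>* \<longrightarrow> a' < b')))"

end

theory Submission
  imports Defs
begin

text \<open>Take a shortest violating computation \<open>\<tau>\<close> and its last command (or barrier). All later events are
  pops, so erasing this command and its pops leaves a computation: only the values that are moved
  around change, and no command reads them any more. It is shorter, hence not violating, so the
  dependencies between the remaining actions are acyclic and can be extended to a linear order, in
  which the erased action is put last. Cut \<open>\<tau>\<close> after the last command and after each of its two pops,
  and sort each of the four parts stably by this order. Events that change places are independent
  and commute, since a dependency against the order would involve the erased action, which only
  occurs at the end of its parts. So the result is a computation with the same dependencies, hence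
  violating, and it is in normal form because all of its parts follow one linear order.\<close>

subsection \<open>Steps as deterministic actions\<close>

text \<open>The linear order lives on identifiers, so a command and its pops share one place in it.
  Accordingly, violation is rephrased as a cycle of \<open>id_order\<close>, the dependencies
  between identifiers. This relation is built from all dependent pairs of events, whereas
  \<open>po\<close> and \<open>cf\<close> link only neighbouring ones. Deleting an action therefore
  merely restricts it, and exchanging independent steps leaves it literally unchanged: the sorted
  run is violating because its relation is the same, and no cycle has to be traced through the
  exchanges. No linear order respects all dependencies of a violating computation. With the erased
  action on top, the only ones that can point downwards are those leaving that action. At most three
  steps carry its identifier, and a cut directly behind each of them moves the later end of such a
  dependency into another part, where it is not compared. This is the origin of the number
  four.\<close>

datatype ('c, 'r) action = Local rank "'r cmd" 'c | PopA rank nat | PopB rank nat | Bar "rank \<Rightarrow> 'c"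

fun cmd_event :: "('c, 'r) state \<Rightarrow> rank \<Rightarrow> 'r cmd \<Rightarrow> event" where
  "cmd_event s r (Load x e) = (KLoad, r, Some (r, val s r e))"
| "cmd_event s r (Store e e') = (KStore, r, Some (r, val s r e))"
| "cmd_event s r (Assign x e) = (KAssign, r, None)"
| "cmd_event s r (Assume e) = (KAssume, r, None)"
| "cmd_event s r (Read la rr ra q) = (KRead, r, None)"
| "cmd_event s r (Write la rr ra q) = (KWrite, r, None)"
| "cmd_event s r Barrier = (KBarrier, r, None)"

fun exec :: "nat \<Rightarrow> rank \<Rightarrow> 'r cmd \<Rightarrow> 'c \<Rightarrow> ('c, 'r) state \<Rightarrow> ('c, 'r) state" where
  "exec n r (Load x e) c s = s\<lparr>sc := (sc s)(r := c), mem := (mem s)((r, Reg x) := mem s (r, Adr (val s r e)))\<rparr>"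
| "exec n r (Store e e') c s = s\<lparr>sc := (sc s)(r := c), mem := (mem s)((r, Adr (val s r e)) := val s r e')\<rparr>"
| "exec n r (Assign x e) c s = s\<lparr>sc := (sc s)(r := c), mem := (mem s)((r, Reg x) := val s r e)\<rparr>"
| "exec n r (Read la rr ra q) c s = s\<lparr>sc := (sc s)(r := c), pq := (pq s)((r, val s r q) :=
     pq s (r, val s r q) @ [(n, val s r rr, val s r ra, r, val s r la)])\<rparr>"
| "exec n r (Write la rr ra q) c s = s\<lparr>sc := (sc s)(r := c), pq := (pq s)((r, val s r q) :=
     pq s (r, val s r q) @ [(n, r, val s r la, val s r rr, val s r ra)])\<rparr>"
| "exec n r _ c s = s\<lparr>sc := (sc s)(r := c)\<rparr>"

fun enabled :: "('c, 'r) program_code \<Rightarrow> nat \<Rightarrow> ('c, 'r) action \<Rightarrow> ('c, 'r) state \<Rightarrow> bool" where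
  "enabled P N (Local r cmd c) s \<longleftrightarrow> r \<in> ranks N \<and> (sc s r, cmd, c) \<in> trans P \<and> cmd \<noteq> Barrier \<and>
     (\<forall>e. cmd = Assume e \<longrightarrow> val s r e \<noteq> 0)"
| "enabled P N (PopA r q) s \<longleftrightarrow> r \<in> ranks N \<and> pq s (r, q) \<noteq> []"
| "enabled P N (PopB r q) s \<longleftrightarrow> r \<in> ranks N \<and> vq s (r, q) \<noteq> []"
| "enabled P N (Bar c) s \<longleftrightarrow> (\<forall>r \<in> ranks N. (sc s r, Barrier, c r) \<in> trans P)"

fun fetch :: "(rank \<times> 'r loc \<Rightarrow> nat) \<Rightarrow> nat \<times> rank \<times> nat \<times> rank \<times> nat \<Rightarrow> nat \<times> rank \<times> nat \<times> nat" where
  "fetch m (i, rs, as, rd, ad) = (i, rd, ad, m (rs, Adr as))"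

fun deliver :: "nat \<times> rank \<times> nat \<times> nat \<Rightarrow> (rank \<times> 'r loc \<Rightarrow> nat) \<Rightarrow> rank \<times> 'r loc \<Rightarrow> nat" where
  "deliver (i, rd, ad, v) m = m((rd, Adr ad) := v)"

fun source :: "nat \<times> rank \<times> nat \<times> rank \<times> nat \<Rightarrow> address" where
  "source (i, rs, as, rd, ad) = (rs, as)"

fun target :: "nat \<times> rank \<times> nat \<times> nat \<Rightarrow> address" where
  "target (i, rd, ad, v) = (rd, ad)"

fun events :: "nat \<Rightarrow> nat \<Rightarrow> ('c, 'r) action \<Rightarrow> ('c, 'r) state \<Rightarrow> tagged_event list" where
  "events N n (Local r cmd c) s = [(cmd_event s r cmd, n)]"
| "events N n (PopA r q) s =
     [((KPopA, r, Some (source (hd (pq s (r, q))))), fst (hd (pq s (r, q))))]"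
| "events N n (PopB r q) s =
     [((KPopB, r, Some (target (hd (vq s (r, q))))), fst (hd (vq s (r, q))))]"
| "events N n (Bar c) s = map (\<lambda>r. ((KBarrier, r, None), n)) [1..<Suc N]"

fun perform :: "nat \<Rightarrow> nat \<Rightarrow> ('c, 'r) action \<Rightarrow> ('c, 'r) state \<Rightarrow> ('c, 'r) state" where
  "perform N n (Local r cmd c) s = exec n r cmd c s"
| "perform N n (PopA r q) s = s\<lparr>pq := (pq s)((r, q) := tl (pq s (r, q))),
     vq := (vq s)((r, q) := vq s (r, q) @ [fetch (mem s) (hd (pq s (r, q)))])\<rparr>"
| "perform N n (PopB r q) s = s\<lparr>vq := (vq s)((r, q) := tl (vq s (r, q))),
     mem := deliver (hd (vq s (r, q))) (mem s)\<rparr>"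
| "perform N n (Bar c) s = s\<lparr>sc := (\<lambda>r. if r \<in> ranks N then c r else sc s r)\<rparr>"

text \<open>The choice of the action absorbs all nondeterminism of a step, so that emitted events
  and successor state are functions of the action and commutation becomes an equation between
  states.\<close>

lemma step_iff:
  "step P N n s es s' \<longleftrightarrow>
   (\<exists>x. enabled P N x s \<and> es = events N n x s \<and> s' = perform N n x s)"
proof
  assume "step P N n s es s'"
  then show "\<exists>x. enabled P N x s \<and> es = events N n x s \<and> s' = perform N n x s"
  proof cases
    case (load r x e c) then show ?thesis by (intro exI[of _ "Local r (Load x e) c"]) simp
  next
    case (store r e e' c) then show ?thesis by (intro exI[of _ "Local r (Store e e') c"]) simp
  next
    case (assign r x e c) then show ?thesis by (intro exI[of _ "Local r (Assign x e) c"]) simp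
  next
    case (assm r e c) then show ?thesis by (intro exI[of _ "Local r (Assume e) c"]) simp
  next
    case (read r la rr ra q c)
    then show ?thesis by (intro exI[of _ "Local r (Read la rr ra q) c"]) simp
  next
    case ("write" r la rr ra q c)
    then show ?thesis by (intro exI[of _ "Local r (Write la rr ra q) c"]) simp
  next
    case (pop_a r q) then show ?thesis by (intro exI[of _ "PopA r q"]) simp
  next
    case (pop_b r q) then show ?thesis by (intro exI[of _ "PopB r q"]) simp
  next
    case (barrier c) then show ?thesis by (intro exI[of _ "Bar c"]) simp
  qed
next
  assume "\<exists>x. enabled P N x s \<and> es = events N n x s \<and> s' = perform N n x s"
  then obtain x where x: "enabled P N x s" and es: "es = events N n x s"
    and s': "s' = perform N n x s" by blast
  show "step P N n s es s'"
  proof (cases x)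
    case (Local r cmd c)
    with x es s' show ?thesis
    proof (cases cmd)
      case (Load x e)
      with Local x es s' step.load[of r N s x e c P n] show ?thesis by simp
    next
      case (Store e e')
      with Local x es s' step.store[of r N s e e' c P n] show ?thesis by simp
    next
      case (Assign x e)
      with Local x es s' step.assign[of r N s x e c P n] show ?thesis by simp
    next
      case (Assume e)
      with Local x es s' step.assm[of r N s e c P n] show ?thesis by simp
    next
      case (Read la rr ra q)
      with Local x es s' step.read[of r N s la rr ra q c P n] show ?thesis by simp
    next
      case (Write la rr ra q)
      with Local x es s' step.write[of r N s la rr ra q c P n] show ?thesis by simp
    qed simp
  next
    case (PopA r q)
    with x es s' show ?thesis
      by (cases "pq s (r, q)") (auto intro: step.pop_a)
  next
    case (PopB r q)
    with x es s' show ?thesis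
      by (cases "vq s (r, q)") (auto intro: step.pop_b)
  next
    case (Bar c)
    with x es s' step.barrier[of N s c P n] show ?thesis by simp
  qed
qed

text \<open>In contrast to \<open>is_pop\<close> and \<open>is_write\<close>, these inspect the
  event itself and not a position, so they survive reordering and erasing.\<close>

fun pops :: "tagged_event \<Rightarrow> bool" where
  "pops ((k, r, x), i) \<longleftrightarrow> k \<in> {KPopA, KPopB}"

fun writes :: "tagged_event \<Rightarrow> bool" where
  "writes ((k, r, x), i) \<longleftrightarrow> k \<in> {KStore, KPopB}"

text \<open>The undirected version of program order and conflict, without the condition that nothing
  lies in between. Events of one action are excluded because they become a single node.\<close>

fun dependent :: "tagged_event \<Rightarrow> tagged_event \<Rightarrow> bool" where
  "dependent ((k, r, x), i) ((k', r', x'), j) \<longleftrightarrow> i \<noteq> j \<and>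
     (\<not> pops ((k, r, x), i) \<and> \<not> pops ((k', r', x'), j) \<and> r = r' \<or>
      x = x' \<and> x \<noteq> None \<and> (writes ((k, r, x), i) \<or> writes ((k', r', x'), j)))"

text \<open>Entries in \<open>vq\<close> are older than those in \<open>pq\<close>, so the
  identifiers appear in the order of issue. A \<open>pop_a\<close> moves an entry across the border
  of the two lists and leaves \<open>pending\<close> unchanged.\<close>

definition pending :: "('c, 'r) state \<Rightarrow> rank \<times> nat \<Rightarrow> nat list" where
  "pending s rq = map fst (vq s rq) @ map fst (pq s rq)"

text \<open>Two pops from the same queue do not commute, but as events do not mention queues this is not
  visible in \<open>dependent\<close>. The entries of a queue were issued in program order, so if program order
  agrees with the linear order \<open>f\<close>, then sorting by \<open>f\<close> never exchanges such pops.\<close>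

definition queues_sorted :: "(nat \<Rightarrow> nat) \<Rightarrow> ('c, 'r) state \<Rightarrow> bool" where
  "queues_sorted f s \<longleftrightarrow> (\<forall>rq. sorted (map f (pending s rq)))"

definition tag :: "tagged_event list \<Rightarrow> nat" where
  "tag es = snd (hd es)"

lemma tag_Cons [simp]: "tag (e # es) = snd e"
  by (simp add: tag_def)

text \<open>Sorts record updates by field, with \<open>sc\<close> innermost and \<open>vq\<close>
  outermost, so that both orders of performing two actions simplify to the same term.\<close>

lemma state_update_order [simp]:
  "sc_update f (mem_update g s) = mem_update g (sc_update f s)"
  "sc_update f (pq_update h s) = pq_update h (sc_update f s)"
  "sc_update f (vq_update k s) = vq_update k (sc_update f s)"
  "mem_update g (pq_update h s) = pq_update h (mem_update g s)"
  "mem_update g (vq_update k s) = vq_update k (mem_update g s)"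
  "pq_update h (vq_update k s) = vq_update k (pq_update h s)"
  by (cases s; simp)+

subsection \<open>Commutation of independent steps\<close>

text \<open>The events have to agree as well, since the addresses and identifiers that an action
  emits depend on the state.\<close>

definition commuting :: "('c, 'r) program_code \<Rightarrow> nat \<Rightarrow> nat \<Rightarrow> nat \<Rightarrow> ('c, 'r) action \<Rightarrow>
    ('c, 'r) action \<Rightarrow> ('c, 'r) state \<Rightarrow> bool" where
  "commuting P N n n' x y s \<longleftrightarrow>
     enabled P N y s \<and> events N n' y (perform N n x s) = events N n' y s \<and>
     enabled P N x (perform N n' y s) \<and> events N n x (perform N n' y s) = events N n x s \<and>
     perform N n x (perform N n' y s) = perform N n' y (perform N n x s)"

text \<open>A command touches only the registers, the memory and the queues of its own rank.\<close>

lemma commuting_Local_Local: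
  assumes "r \<noteq> r'" and "enabled P N (Local r cmd c) s"
    and "enabled P N (Local r' cmd' c') (perform N n (Local r cmd c) s)"
  shows "commuting P N n n' (Local r cmd c) (Local r' cmd' c') s"
  using assms unfolding commuting_def
  by (cases cmd; cases cmd') (simp_all add: val_def fun_upd_twist)

text \<open>Interference could come from a store to the fetched address, which is a dependency, or
  from the command issuing the very entry that is popped, which the premise on identifiers excludes.
  Any other new entry goes to the tail of a queue whose head is already there.\<close>

lemma commuting_Local_PopA:
  assumes "enabled P N (Local r cmd c) s"
    and "enabled P N (PopA r' q) (perform N n (Local r cmd c) s)"
    and "\<not> dependent (hd (events N n (Local r cmd c) s))
       (hd (events N n' (PopA r' q) (perform N n (Local r cmd c) s)))"
    and "tag (events N n' (PopA r' q) (perform N n (Local r cmd c) s)) \<noteq> n"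
  shows "commuting P N n n' (Local r cmd c) (PopA r' q) s"
proof (cases "pq s (r', q)")
  case Nil
  with assms show ?thesis by (cases cmd) (simp_all add: val_def split: if_splits)
next
  case (Cons e es)
  obtain i rs as rd ad where "e = (i, rs, as, rd, ad)" by (cases e)
  with assms Cons show ?thesis unfolding commuting_def
    by (cases cmd) (auto simp: val_def fun_upd_twist)
qed

lemma commuting_PopA_Local:
  assumes "enabled P N (PopA r' q) s"
    and "enabled P N (Local r cmd c) (perform N n (PopA r' q) s)"
    and "\<not> dependent (hd (events N n (PopA r' q) s))
       (hd (events N n' (Local r cmd c) (perform N n (PopA r' q) s)))"
    and "tag (events N n (PopA r' q) s) \<noteq> n'"
  shows "commuting P N n n' (PopA r' q) (Local r cmd c) s"
proof (cases "pq s (r', q)")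
  case (Cons e es)
  obtain i rs as rd ad where "e = (i, rs, as, rd, ad)" by (cases e)
  with assms Cons show ?thesis unfolding commuting_def
    by (cases cmd) (auto simp: val_def fun_upd_twist)
qed (use assms in simp)

lemma commuting_Local_PopB:
  assumes "enabled P N (Local r cmd c) s"
    and "enabled P N (PopB r' q) (perform N n (Local r cmd c) s)"
    and "\<not> dependent (hd (events N n (Local r cmd c) s))
       (hd (events N n' (PopB r' q) (perform N n (Local r cmd c) s)))"
    and "tag (events N n' (PopB r' q) (perform N n (Local r cmd c) s)) \<noteq> n"
  shows "commuting P N n n' (Local r cmd c) (PopB r' q) s"
proof (cases "vq s (r', q)")
  case Nil
  with assms show ?thesis by (cases cmd) simp_all
next
  case (Cons e es)
  obtain i rd ad v where "e = (i, rd, ad, v)" by (cases e)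
  with assms Cons show ?thesis unfolding commuting_def
    by (cases cmd) (auto simp: val_def fun_upd_twist)
qed

text \<open>Expressions read registers and pops write addresses, so a delivered value cannot change
  an operand of the command; only accesses to the delivered address matter.\<close>

lemma commuting_PopB_Local:
  assumes "enabled P N (PopB r' q) s"
    and "enabled P N (Local r cmd c) (perform N n (PopB r' q) s)"
    and "\<not> dependent (hd (events N n (PopB r' q) s))
       (hd (events N n' (Local r cmd c) (perform N n (PopB r' q) s)))"
    and "tag (events N n (PopB r' q) s) \<noteq> n'"
  shows "commuting P N n n' (PopB r' q) (Local r cmd c) s"
proof (cases "vq s (r', q)")
  case (Cons e es)
  obtain i rd ad v where "e = (i, rd, ad, v)" by (cases e)
  with assms Cons show ?thesis unfolding commuting_def
    by (cases cmd) (auto simp: val_def fun_upd_twist)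
qed (use assms in simp)

lemma commuting_PopA_PopA:
  assumes "enabled P N (PopA r q) s" and "enabled P N (PopA r' q') s" and "(r, q) \<noteq> (r', q')"
  shows "commuting P N n n' (PopA r q) (PopA r' q') s"
  using assms by (auto simp: commuting_def fun_upd_twist)

lemma commuting_PopB_PopB:
  assumes "enabled P N (PopB r q) s" and "enabled P N (PopB r' q') s" and "(r, q) \<noteq> (r', q')"
    and "target (hd (vq s (r, q))) \<noteq> target (hd (vq s (r', q')))"
  shows "commuting P N n n' (PopB r q) (PopB r' q') s"
  using assms
  by (cases "hd (vq s (r, q))"; cases "hd (vq s (r', q'))") (auto simp: commuting_def fun_upd_twist)

lemma commuting_PopA_PopB:
  assumes "enabled P N (PopA r q) s" and "enabled P N (PopB r' q') (perform N n (PopA r q) s)"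
    and "\<not> dependent (hd (events N n (PopA r q) s))
       (hd (events N n' (PopB r' q') (perform N n (PopA r q) s)))"
    and "tag (events N n (PopA r q) s) \<noteq> tag (events N n' (PopB r' q') (perform N n (PopA r q) s))"
  shows "commuting P N n n' (PopA r q) (PopB r' q') s"
proof (cases "vq s (r', q')")
  \<comment> \<open>With \<open>vq\<close> empty before, the \<open>pop_b\<close> would handle the
    entry just fetched, and the identifiers would agree.\<close>
  case Nil
  with assms show ?thesis
    by (cases "hd (pq s (r, q))") (auto split: if_splits)
next
  case (Cons e es)
  obtain i rd ad v where "e = (i, rd, ad, v)" by (cases e)
  with assms Cons show ?thesis unfolding commuting_def
    by (cases "hd (pq s (r, q))") (auto simp: fun_upd_twist)
qed

lemma commuting_PopB_PopA:
  assumes "enabled P N (PopB r' q') s" and "enabled P N (PopA r q) s"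
    and "target (hd (vq s (r', q'))) \<noteq> source (hd (pq s (r, q)))"
  shows "commuting P N n n' (PopB r' q') (PopA r q) s"
proof (cases "vq s (r', q')")
  case (Cons e es)
  obtain i rd ad v where "e = (i, rd, ad, v)" by (cases e)
  with assms Cons show ?thesis unfolding commuting_def
    by (cases "hd (pq s (r, q))") (auto simp: fun_upd_twist)
qed (use assms in simp)

text \<open>Pops neither read nor change \<open>sc\<close>, the only component that a barrier
  touches.\<close>

lemma commuting_pop_Bar:
  assumes "enabled P N x s" and "\<forall>r cmd c. x \<noteq> Local r cmd c" and "\<forall>c. x \<noteq> Bar c"
    and "enabled P N (Bar c) (perform N n x s)"
  shows "commuting P N n n' x (Bar c) s"
  using assms by (cases x) (auto simp: commuting_def cong: if_cong)

lemma commuting_Bar_pop: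
  assumes "enabled P N x s" and "\<forall>r cmd c. x \<noteq> Local r cmd c" and "\<forall>c. x \<noteq> Bar c"
    and "enabled P N (Bar c) s"
  shows "commuting P N n n' (Bar c) x s"
  using assms by (cases x) (auto simp: commuting_def cong: if_cong)

text \<open>The premise \<open>less\<close> acts twice. It separates the identifiers, without which
  \<open>indep\<close> would say nothing, and it rules out two pops of one queue, since these handle
  the first two entries, which are in ascending order under \<open>f\<close>.\<close>

lemma step_commute:
  assumes "step P N n s es s1" and "step P N n' s1 es' s2"
    and "queues_sorted f s" and less: "f (tag es') < f (tag es)"
    and indep: "\<forall>e \<in> set es. \<forall>e' \<in> set es'. \<not> dependent e e'"
    and "es \<noteq> []" and "es' \<noteq> []"
  shows "\<exists>t. step P N n' s es' t \<and> step P N n t es s2"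
proof -
  from assms(1,2) obtain x y where x: "enabled P N x s" "es = events N n x s" "s1 = perform N n x s"
    and y: "enabled P N y s1" "es' = events N n' y s1" "s2 = perform N n' y s1"
    unfolding step_iff by blast
  note * = x y less
  have hd: "\<not> dependent (hd es) (hd es')" using assms(6,7) indep by auto
  have tags: "tag es \<noteq> tag es'" using less by auto
  have "commuting P N n n' x y s"
  proof (cases x)
    case xL: (Local r cmd c)
    show ?thesis
    proof (cases y)
      case yL: (Local r' cmd' c')
      have "r \<noteq> r'" using hd tags x(2) y(2) xL yL by (cases cmd; cases cmd') auto
      then show ?thesis using commuting_Local_Local * xL yL by metis
    next
      case (PopA r' q)
      then show ?thesis using commuting_Local_PopA[of P N r cmd c s r' q n n'] * hd tags xL by auto
    next
      case (PopB r' q)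
      then show ?thesis using commuting_Local_PopB[of P N r cmd c s r' q n n'] * hd tags xL by auto
    next
      case (Bar c')
      \<comment> \<open>A barrier emits an event for every rank, so it depends on every command with
        another identifier.\<close>
      have "((KBarrier, r, None), n') \<in> set es'" using x y xL Bar by (auto simp: ranks_def)
      then have "\<not> dependent (hd es) ((KBarrier, r, None), n')" using indep assms(6) by auto
      moreover have "n \<noteq> n'" using tags x y xL Bar assms(7) by (auto simp: tag_def hd_map simp del: upt_Suc)
      ultimately show ?thesis using x xL by (cases cmd) auto
    qed
  next
    case xA: (PopA r q)
    show ?thesis
    proof (cases y)
      case yL: (Local r' cmd' c')
      then show ?thesis using commuting_PopA_Local[of P N r q s r' cmd' c' n n'] * hd tags xA by auto
    next
      case (PopA r' q')
      have "(r, q) \<noteq> (r', q')"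
      proof
        assume "(r, q) = (r', q')"
        then obtain e e' l where "pq s (r, q) = e # e' # l" "tag es = fst e" "tag es' = fst e'"
          using x y xA PopA by (cases "pq s (r, q)"; cases "tl (pq s (r, q))") auto
        moreover have "sorted (map f (pending s (r, q)))" using assms(3) by (simp add: queues_sorted_def)
        ultimately show False using less by (auto simp: pending_def sorted_append)
      qed
      then show ?thesis using commuting_PopA_PopA[of P N r q s r' q'] x y xA PopA by auto
    next
      case (PopB r' q')
      then show ?thesis using commuting_PopA_PopB[of P N r q s r' q' n n'] * hd tags xA by auto
    next
      case (Bar c')
      then show ?thesis using * commuting_pop_Bar[of P N x s c' n n'] xA by simp
    qed
  next
    case xB: (PopB r q)
    show ?thesis
    proof (cases y)
      case yL: (Local r' cmd' c')
      then show ?thesis using commuting_PopB_Local[of P N r q s r' cmd' c' n n'] * hd tags xB by auto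
    next
      case (PopA r' q')
      then show ?thesis using commuting_PopB_PopA[of P N r q s r' q'] * hd tags xB by auto
    next
      case (PopB r' q')
      have "(r, q) \<noteq> (r', q')"
      proof
        assume "(r, q) = (r', q')"
        then obtain e e' l where "vq s (r, q) = e # e' # l" "tag es = fst e" "tag es' = fst e'"
          using x y xB PopB by (cases "vq s (r, q)"; cases "tl (vq s (r, q))") auto
        moreover have "sorted (map f (pending s (r, q)))" using assms(3) by (simp add: queues_sorted_def)
        ultimately show False using less by (auto simp: pending_def sorted_append)
      qed
      then show ?thesis using commuting_PopB_PopB[of P N r q s r' q'] * hd tags xB PopB by auto
    next
      case (Bar c')
      then show ?thesis using * commuting_pop_Bar[of P N x s c' n n'] xB by simp
    qed
  next
    case xBar: (Bar c)
    show ?thesis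
    proof (cases y)
      case yL: (Local r cmd c')
      have "((KBarrier, r, None), n) \<in> set es" using x y xBar yL by (auto simp: ranks_def)
      then have "\<not> dependent ((KBarrier, r, None), n) (hd es')" using indep assms(7) by auto
      moreover have "n \<noteq> n'" using tags x y xBar yL assms(6) by (auto simp: tag_def hd_map simp del: upt_Suc)
      ultimately show ?thesis using y yL by (cases cmd) auto
    next
      case (PopA r' q')
      then show ?thesis using * xBar commuting_Bar_pop[of P N y s c n n'] by simp
    next
      case (PopB r' q')
      then show ?thesis using * xBar commuting_Bar_pop[of P N y s c n n'] by simp
    next
      case (Bar c')
      \<comment> \<open>Nonempty barriers force \<open>N\<close> to be positive, so both heads are
        barrier events of rank 1 and hence dependent.\<close>
      then show ?thesis using hd tags x y xBar assms(6,7) by (auto simp: tag_def hd_map simp del: upt_Suc)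
    qed
  qed
  then show ?thesis using * unfolding commuting_def step_iff by metis
qed

section \<open>What a single step does to queues and identifiers\<close>

abbreviation rank_of :: "tagged_event \<Rightarrow> rank" where
  "rank_of e \<equiv> fst (snd (fst e))"

text \<open>Coarser than the rules of \<open>step\<close>: for queues and identifiers the six
  commands behave alike and form one case.\<close>

lemma step_cases:
  assumes "step P N n s es s'"
  obtains (command) e where "es = [e]" "\<not> pops e" "snd e = n"
      "\<And>rq. pending s' rq = pending s rq \<or> rank_of e = fst rq \<and> pending s' rq = pending s rq @ [n]"
  | (pop_a) rq i rs as rd ad l where
      "fst rq \<in> ranks N" "pq s rq = (i, rs, as, rd, ad) # l"
      "es = [((KPopA, fst rq, Some (rs, as)), i)]"
      "s' = s\<lparr>pq := (pq s)(rq := l), vq := (vq s)(rq := vq s rq @ [(i, rd, ad, mem s (rs, Adr as))])\<rparr>"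
  | (pop_b) rq i rd ad v l where
      "fst rq \<in> ranks N" "vq s rq = (i, rd, ad, v) # l"
      "es = [((KPopB, fst rq, Some (rd, ad)), i)]"
      "s' = s\<lparr>vq := (vq s)(rq := l), mem := (mem s)((rd, Adr ad) := v)\<rparr>"
  | (barrier) c where "es = map (\<lambda>r. ((KBarrier, r, None), n)) [1..<Suc N]" "pq s' = pq s" "vq s' = vq s"
       "s' = s\<lparr>sc := (\<lambda>r. if r \<in> ranks N then c r else sc s r)\<rparr>"
  using assms
proof cases
  case (pop_a r q i rs as rd ad es)
  then show ?thesis using that(2)[of "(r, q)"] by simp
next
  case (pop_b r q i rd ad v es)
  then show ?thesis using that(3)[of "(r, q)"] by simp
next
  case (barrier c)
  then show ?thesis using that(4)[of c] by simp
qed (rule that(1), auto simp: pending_def)+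

lemma step_block:
  assumes "step P N n s es s'" and "es \<noteq> []"
  shows "\<forall>e \<in> set es. snd e = tag es"
    and "(\<forall>e \<in> set es. pops e) \<or> (\<forall>e \<in> set es. \<not> pops e \<and> snd e = n)"
proof -
  consider e where "es = [e]" "pops e" | "\<forall>e \<in> set es. \<not> pops e \<and> snd e = n"
    using assms(1)
  proof (cases rule: step_cases)
    case (command e)
    then show ?thesis using that(2) by simp
  next
    case (pop_a rq i rs as rd ad l)
    then show ?thesis using that(1)[OF pop_a(3)] by simp
  next
    case (pop_b rq i rd ad v l)
    then show ?thesis using that(1)[OF pop_b(3)] by simp
  next
    case (barrier c)
    then show ?thesis using that(2) by auto
  qed
  then show "\<forall>e \<in> set es. snd e = tag es"
    and "(\<forall>e \<in> set es. pops e) \<or> (\<forall>e \<in> set es. \<not> pops e \<and> snd e = n)"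
    using assms(2) by (cases; simp add: tag_def)+
qed

text \<open>Pops emit the identifier of their entry and ignore the one offered, so freshness of the
  latter can always be restored after an exchange.\<close>

lemma step_pops_any_id:
  assumes "step P N n s es s'" and "\<forall>e \<in> set es. pops e" and "es \<noteq> []"
  shows "step P N m s es s'"
proof -
  obtain x where x: "enabled P N x s" "es = events N n x s" "s' = perform N n x s"
    using assms(1) unfolding step_iff by blast
  have "events N m x s = events N n x s \<and> perform N m x s = perform N n x s"
  proof (cases x)
    case (Local r cmd c)
    with x assms(2) show ?thesis by (cases cmd) auto
  next
    case (Bar c)
    with x assms(2,3) show ?thesis by (auto simp del: upt_Suc)
  qed auto
  with x show ?thesis unfolding step_iff by metis
qed

lemma step_pending:
  assumes "step P N n s es s'"
  shows "pending s' rq = pending s rq \<or> pending s' rq = tl (pending s rq) \<or>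
    (\<exists>e. es = [e] \<and> \<not> pops e \<and> snd e = n \<and> rank_of e = fst rq \<and> pending s' rq = pending s rq @ [n])"
  using assms
proof (cases rule: step_cases)
  case (command e)
  then show ?thesis using command(1-3) command(4)[of rq] by blast
next
  case (barrier c)
  then show ?thesis by (simp add: pending_def)
qed (auto simp: pending_def)

section \<open>Runs as lists of steps\<close>

text \<open>Keeping the events of a step together makes barriers movable as a whole. Steps that emit nothing
  (barriers with \<open>N = 0\<close>) do not change the state and are dropped.\<close>

inductive blocks :: "('c, 'r) program_code \<Rightarrow> nat \<Rightarrow> tagged_event list list \<Rightarrow> ('c, 'r) state \<Rightarrow> bool"
  for P :: "('c, 'r) program_code" and N :: nat where
  start: "blocks P N [] (initial_state P)"
| extend: "blocks P N bs s \<Longrightarrow> n \<notin> snd ` set (concat bs) \<Longrightarrow> step P N n s es s' \<Longrightarrow> es \<noteq> [] \<Longrightarrow>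
    blocks P N (bs @ [es]) s'"

lemma blocks_snoc:
  "blocks P N (bs @ [es]) s' \<longleftrightarrow>
   (\<exists>s n. blocks P N bs s \<and> n \<notin> snd ` set (concat bs) \<and> step P N n s es s' \<and> es \<noteq> [])"
  by (subst blocks.simps) auto

lemma blocks_Nil: "blocks P N [] s \<longleftrightarrow> s = initial_state P"
  by (subst blocks.simps) auto

lemma blocks_imp_run: "blocks P N bs s \<Longrightarrow> run P N (concat bs) s"
proof (induction rule: blocks.induct)
  case (extend bs s n es s')
  from run.extend[OF extend.IH extend.hyps(2,3)] show ?case by simp
qed (simp add: run.start)

lemma run_imp_blocks: "run P N \<tau> s \<Longrightarrow> \<exists>bs. blocks P N bs s \<and> concat bs = \<tau>"
proof (induction rule: run.induct)
  case start
  then show ?case by (auto simp: blocks_Nil intro: exI[of _ "[]"])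
next
  case (extend \<tau> s n es s')
  then obtain bs where bs: "blocks P N bs s" "concat bs = \<tau>" by blast
  show ?case
  proof (cases "es = []")
    case True
    with extend.hyps(3) have "s' = s"
    proof (cases rule: step_cases)
      case (barrier c)
      from barrier(1) True have "ranks N = {}" by (auto simp: ranks_def)
      with barrier(4) show ?thesis by simp
    qed simp_all
    with True bs show ?thesis by auto
  next
    case False
    with bs extend.hyps show ?thesis by (intro exI[of _ "bs @ [es]"]) (auto simp: blocks_snoc)
  qed
qed

lemma computations_iff_blocks:
  "\<tau> \<in> computations P N \<longleftrightarrow> (\<exists>bs s. blocks P N bs s \<and> queues_empty s \<and> concat bs = \<tau>)"
  unfolding computations_def using run_imp_blocks blocks_imp_run by blast

lemma blocks_uniform:
  "blocks P N bs s \<Longrightarrow> b \<in> set bs \<Longrightarrow> b \<noteq> [] \<and> (\<forall>e \<in> set b. snd e = tag b) \<and>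
     ((\<forall>e \<in> set b. pops e) \<or> (\<forall>e \<in> set b. \<not> pops e))"
proof (induction rule: blocks.induct)
  case (extend bs s n es s')
  then show ?case using step_block[OF extend.hyps(3,4)] by auto
qed simp

lemma set_tl_subset: "set (tl xs) \<subseteq> set xs"
  by (cases xs) auto

lemma pending_origin:
  "blocks P N bs s \<Longrightarrow> i \<in> set (pending s rq) \<Longrightarrow>
   \<exists>e \<in> set (concat bs). \<not> pops e \<and> rank_of e = fst rq \<and> snd e = i"
proof (induction rule: blocks.induct)
  case start
  then show ?case by (simp add: initial_state_def pending_def)
next
  case (extend bs s n es s')
  show ?case
  proof (cases "i \<in> set (pending s rq)")
    case True
    then show ?thesis using extend.IH by auto
  next
    case False
    then have "\<exists>e. es = [e] \<and> \<not> pops e \<and> snd e = i \<and> rank_of e = fst rq"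
      using step_pending[OF extend.hyps(3), of rq] set_tl_subset[of "pending s rq"] extend.prems
      by auto
    then show ?thesis by auto
  qed
qed

definition program_ordered :: "(nat \<Rightarrow> nat) \<Rightarrow> tagged_event list \<Rightarrow> tagged_event list \<Rightarrow> bool" where
  "program_ordered f b b' \<longleftrightarrow> (\<forall>e \<in> set b. \<forall>e' \<in> set b'.
     \<not> pops e \<longrightarrow> \<not> pops e' \<longrightarrow> rank_of e = rank_of e' \<longrightarrow> f (snd e) \<le> f (snd e'))"

lemma queues_sorted:
  "blocks P N bs s \<Longrightarrow> sorted_wrt (program_ordered f) bs \<Longrightarrow> queues_sorted f s"
proof (induction rule: blocks.induct)
  case start
  then show ?case by (simp add: queues_sorted_def initial_state_def pending_def)
next
  case (extend bs s n es s')
  have srt: "sorted (map f (pending s rq))" for rq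
    using extend by (simp add: queues_sorted_def sorted_wrt_append del: split_paired_All)
  have "sorted (map f (pending s' rq))" for rq
    using step_pending[OF extend.hyps(3), of rq]
  proof (elim disjE exE conjE)
    assume "pending s' rq = tl (pending s rq)"
    then show ?thesis using srt[of rq] by (simp add: map_tl sorted_tl)
  next
    fix e assume e: "es = [e]" "\<not> pops e" "snd e = n" "rank_of e = fst rq"
      and p: "pending s' rq = pending s rq @ [n]"
    \<comment> \<open>All entries of a queue were issued by earlier commands of the rank that owns
      it.\<close>
    have "f i \<le> f n" if i: "i \<in> set (pending s rq)" for i
    proof -
      obtain e' b where "b \<in> set bs" "e' \<in> set b" "\<not> pops e'" "rank_of e' = fst rq" "snd e' = i"
        using pending_origin[OF extend.hyps(1) i] by auto
      then show ?thesis
        using extend.prems e unfolding sorted_wrt_append program_ordered_def by fastforce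
    qed
    then show ?thesis using srt[of rq] p by (simp add: sorted_append)
  qed (use srt in simp)
  then show ?case by (simp add: queues_sorted_def)
qed

section \<open>Exchanging adjacent steps of a run\<close>

text \<open>A step depends on its past only through the state reached and, by freshness, through the
  set of identifiers in use. A prefix may be replaced by any other that agrees in these two.\<close>

lemma blocks_append:
  "blocks P N (bs @ ds) s \<Longrightarrow> \<exists>t. blocks P N bs t \<and>
     (\<forall>cs. blocks P N cs t \<longrightarrow> snd ` set (concat cs) = snd ` set (concat bs) \<longrightarrow> blocks P N (cs @ ds) s)"
proof (induction ds arbitrary: s rule: rev_induct)
  case (snoc d ds)
  from snoc.prems obtain t n where t: "blocks P N (bs @ ds) t" "n \<notin> snd ` set (concat (bs @ ds))"
    "step P N n t d s" "d \<noteq> []"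
    by (auto simp: blocks_snoc simp flip: append_assoc)
  from snoc.IH[OF t(1)] obtain u where u: "blocks P N bs u"
    "\<And>cs. blocks P N cs u \<Longrightarrow> snd ` set (concat cs) = snd ` set (concat bs) \<Longrightarrow> blocks P N (cs @ ds) t"
    by blast
  have "blocks P N (cs @ ds @ [d]) s"
    if "blocks P N cs u" "snd ` set (concat cs) = snd ` set (concat bs)" for cs
    using u(2)[OF that] t(2-) that(2) blocks_snoc[of P N "cs @ ds" d s] by (auto simp: image_Un)
  with u(1) show ?case by blast
qed auto

lemma blocks_swap:
  assumes "blocks P N (bs @ x # y # ds) s" and "sorted_wrt (program_ordered f) bs"
    and "f (tag y) < f (tag x)" and "\<forall>e \<in> set x. \<forall>e' \<in> set y. \<not> dependent e e'"
  shows "blocks P N (bs @ y # x # ds) s"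
proof -
  from blocks_append[of P N "bs @ [x, y]" ds s] assms(1) obtain s2 where
    s2: "blocks P N ((bs @ [x]) @ [y]) s2" and
    rest: "\<And>cs. blocks P N cs s2 \<Longrightarrow> snd ` set (concat cs) = snd ` set (concat (bs @ [x, y]))
      \<Longrightarrow> blocks P N (cs @ ds) s" by auto
  from s2 obtain s0 n s1 n' where s0: "blocks P N bs s0" and n: "n \<notin> snd ` set (concat bs)"
    and x: "step P N n s0 x s1" "x \<noteq> []" and n': "n' \<notin> snd ` set (concat (bs @ [x]))"
    and y: "step P N n' s1 y s2" "y \<noteq> []"
    unfolding blocks_snoc by blast
  obtain t where t: "step P N n' s0 y t" "step P N n t x s2"
    using step_commute[OF x(1) y(1) queues_sorted[OF s0 assms(2)] assms(3,4) x(2) y(2)] by blast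
  have bsy: "blocks P N (bs @ [y]) t" using s0 n' t(1) y(2) by (auto simp: blocks_snoc)
  obtain m where m: "m \<notin> snd ` set (concat (bs @ [x, y]))"
    using ex_new_if_finite[of "snd ` set (concat (bs @ [x, y]))"] infinite_UNIV_nat by auto
  have "\<exists>k. k \<notin> snd ` set (concat (bs @ [y])) \<and> step P N k t x s2"
  proof (cases "n \<in> snd ` set y")
    case False
    then show ?thesis using n t(2) by (intro exI[of _ n]) auto
  next
    case True
    then have "\<not> (\<forall>e \<in> set x. snd e = n)"
      using assms(3) x(2) step_block(1)[OF y] by (metis imageE less_irrefl list.set_sel(1) tag_def)
    then have p: "\<forall>e \<in> set x. pops e" using step_block(2)[OF x] by auto
    have "step P N m t x s2"
      using step_pops_any_id[OF t(2) p x(2)] .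
    then show ?thesis using m by (intro exI[of _ m]) auto
  qed
  then have "blocks P N ((bs @ [y]) @ [x]) s2" using bsy x(2) by (auto simp only: blocks_snoc)
  then show ?thesis using rest[of "bs @ [y, x]"] by (auto simp: image_Un Un_ac)
qed

subsection \<open>Violation as a cycle between identifiers\<close>

lemma dependent_sym: "dependent e e' \<longleftrightarrow> dependent e' e"
  by (cases "(e, e')" rule: dependent.cases) auto

declare dependent.simps [simp del]

primrec id_order :: "tagged_event list \<Rightarrow> (nat \<times> nat) set" where
  "id_order [] = {}"
| "id_order (e # es) = {(snd e, snd e') | e'. e' \<in> set es \<and> dependent e e'} \<union> id_order es"

lemma id_order_append:
  "id_order (xs @ ys) = id_order xs \<union> id_order ys \<union>
     {(snd e, snd e') | e e'. e \<in> set xs \<and> e' \<in> set ys \<and> dependent e e'}"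
  by (induction xs) (simp, simp only: append_Cons id_order.simps set_append set_simps, blast)

lemma id_order_subset: "id_order es \<subseteq> snd ` set es \<times> snd ` set es"
  by (induction es) (simp, simp only: id_order.simps set_simps, blast)

text \<open>The analogue for \<open>po\<close> and \<open>cf\<close> fails: deleting an event turns
  the events around it into neighbours and creates new edges.\<close>

lemma id_order_filter:
  "id_order (filter (\<lambda>e. snd e \<noteq> a) es) = {(i, j) \<in> id_order es. i \<noteq> a \<and> j \<noteq> a}"
proof (induction es)
  case (Cons e es)
  then show ?case by (cases "snd e = a") (simp_all, blast+)
qed simp

lemma id_order_nth:
  "id_order es = {(snd (es ! i), snd (es ! j)) | i j. i < j \<and> j < length es \<and> dependent (es ! i) (es ! j)}"
proof (induction es)
  case (Cons e es)
  show ?case (is "?l = ?r")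
  proof
    show "?l \<subseteq> ?r"
    proof
      fix p assume "p \<in> ?l"
      then consider e' where "p = (snd e, snd e')" "e' \<in> set es" "dependent e e'" | "p \<in> id_order es" by auto
      then show "p \<in> ?r"
      proof cases
        case 1
        then obtain j where "j < length es" "es ! j = e'" by (auto simp: in_set_conv_nth)
        with 1 show ?thesis
          unfolding mem_Collect_eq by - (rule exI[of _ 0], rule exI[of _ "Suc j"], simp)
      next
        case 2
        then obtain i j where "i < j" "j < length es" "dependent (es ! i) (es ! j)"
          "p = (snd (es ! i), snd (es ! j))" unfolding Cons by auto
        then show ?thesis
          unfolding mem_Collect_eq by - (rule exI[of _ "Suc i"], rule exI[of _ "Suc j"], simp)
      qed
    qed
    show "?r \<subseteq> ?l"
    proof
      fix p assume "p \<in> ?r"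
      then obtain i j where ij: "i < j" "j < length (e # es)"
        "dependent ((e # es) ! i) ((e # es) ! j)" "p = (snd ((e # es) ! i), snd ((e # es) ! j))" by auto
      then obtain j' where j': "j = Suc j'" by (cases j) auto
      show "p \<in> ?l"
      proof (cases i)
        case 0
        with ij j' have "p = (snd e, snd (es ! j'))" "es ! j' \<in> set es" "dependent e (es ! j')"
          by auto
        then show ?thesis unfolding id_order.simps by blast
      next
        case (Suc i')
        with ij j' show ?thesis unfolding id_order.simps Cons by auto
      qed
    qed
  qed
qed simp

text \<open>Happens-before with the classes of \<open>same_action\<close> contracted. Edges inside a
  class are dropped, for instance the conflict between the two pops of an entry whose source and
  target coincide.\<close>

definition id_edges :: "tagged_event list \<Rightarrow> (nat \<times> nat) set" where
  "id_edges \<tau> = {(ev_id \<tau> i, ev_id \<tau> j) | i j. (i, j) \<in> po \<tau> \<union> cf \<tau> \<and> ev_id \<tau> i \<noteq> ev_id \<tau> j}"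

lemma dependent_nth:
  "dependent (\<tau> ! i) (\<tau> ! j) \<longleftrightarrow> ev_id \<tau> i \<noteq> ev_id \<tau> j \<and>
     (\<not> is_pop \<tau> i \<and> \<not> is_pop \<tau> j \<and> ev_rank \<tau> i = ev_rank \<tau> j \<or>
      ev_addr \<tau> i = ev_addr \<tau> j \<and> ev_addr \<tau> i \<noteq> None \<and> (is_write \<tau> i \<or> is_write \<tau> j))"
  unfolding ev_id_def ev_rank_def ev_addr_def is_pop_def is_write_def ev_kind_def
  by (cases "(\<tau> ! i, \<tau> ! j)" rule: dependent.cases) (auto simp: dependent.simps)

lemma edge_id_edges: "(i, j) \<in> po \<tau> \<union> cf \<tau> \<Longrightarrow> (ev_id \<tau> i, ev_id \<tau> j) \<in> (id_edges \<tau>)\<^sup>*"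
  by (cases "ev_id \<tau> i = ev_id \<tau> j") (auto simp: id_edges_def intro!: r_into_rtrancl)

lemma program_order_id_edges:
  "i < j \<Longrightarrow> j < length \<tau> \<Longrightarrow> ev_rank \<tau> i = ev_rank \<tau> j \<Longrightarrow> \<not> is_pop \<tau> i \<Longrightarrow> \<not> is_pop \<tau> j \<Longrightarrow>
   (ev_id \<tau> i, ev_id \<tau> j) \<in> (id_edges \<tau>)\<^sup>*"
proof (induction "j - i" arbitrary: i j rule: less_induct)
  case less
  show ?case
  proof (cases "\<exists>k. i < k \<and> k < j \<and> ev_rank \<tau> k = ev_rank \<tau> i \<and> \<not> is_pop \<tau> k")
    case True
    then obtain k where k: "i < k" "k < j" "ev_rank \<tau> k = ev_rank \<tau> i" "\<not> is_pop \<tau> k" by blast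
    then have "k - i < j - i" "j - k < j - i" by auto
    then show ?thesis using k less.hyps[of k i] less.hyps[of j k] less.prems by (auto intro: rtrancl_trans)
  next
    case False
    then have "(i, j) \<in> po \<tau>" using less.prems by (auto simp: po_def)
    then show ?thesis using edge_id_edges by blast
  qed
qed

text \<open>A write in between conflicts with both ends, so the interval can be divided there. The
  closure is reflexive because the event in between may share an identifier with an end.\<close>

lemma conflict_id_edges:
  "i < j \<Longrightarrow> j < length \<tau> \<Longrightarrow> ev_addr \<tau> i = Some x \<Longrightarrow> ev_addr \<tau> j = Some x \<Longrightarrow>
   is_write \<tau> i \<or> is_write \<tau> j \<Longrightarrow> (ev_id \<tau> i, ev_id \<tau> j) \<in> (id_edges \<tau>)\<^sup>*"
proof (induction "j - i" arbitrary: i j rule: less_induct)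
  case less
  show ?case
  proof (cases "\<exists>k. i < k \<and> k < j \<and> is_write \<tau> k \<and> ev_addr \<tau> k = Some x")
    case True
    then obtain k where k: "i < k" "k < j" "is_write \<tau> k" "ev_addr \<tau> k = Some x" by blast
    then have "k - i < j - i" "j - k < j - i" by auto
    then show ?thesis using k less.hyps[of k i] less.hyps[of j k] less.prems by (auto intro: rtrancl_trans)
  next
    case False
    then have "(i, j) \<in> cf \<tau>" using less.prems by (auto simp: cf_def simp del: split_paired_Ex)
    then show ?thesis using edge_id_edges by blast
  qed
qed

lemma id_edges_trancl: "(id_edges \<tau>)\<^sup>+ = (id_order \<tau>)\<^sup>+"
proof
  have "id_edges \<tau> \<subseteq> id_order \<tau>"
    unfolding id_order_nth id_edges_def
    by (fastforce simp: dependent_nth po_def cf_def ev_id_def[symmetric])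
  then show "(id_edges \<tau>)\<^sup>+ \<subseteq> (id_order \<tau>)\<^sup>+" by (rule trancl_mono_subset)
next
  have "id_order \<tau> \<subseteq> (id_edges \<tau>)\<^sup>+"
  proof
    fix p assume "p \<in> id_order \<tau>"
    then obtain i j where ij: "i < j" "j < length \<tau>" "dependent (\<tau> ! i) (\<tau> ! j)"
      and p: "p = (ev_id \<tau> i, ev_id \<tau> j)" by (auto simp: id_order_nth ev_id_def)
    from ij(3) consider "\<not> is_pop \<tau> i" "\<not> is_pop \<tau> j" "ev_rank \<tau> i = ev_rank \<tau> j"
      | x where "ev_addr \<tau> i = Some x" "ev_addr \<tau> j = Some x" "is_write \<tau> i \<or> is_write \<tau> j"
      unfolding dependent_nth by (metis option.exhaust)
    then have "p \<in> (id_edges \<tau>)\<^sup>*"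
      unfolding p by cases (use ij(1,2) program_order_id_edges conflict_id_edges in metis)+
    \<comment> \<open>Dependent events carry distinct identifiers, so the path is not empty.\<close>
    then show "p \<in> (id_edges \<tau>)\<^sup>+" using ij(3) p by (auto simp: dependent_nth rtrancl_eq_or_trancl)
  qed
  then show "(id_order \<tau>)\<^sup>+ \<subseteq> (id_edges \<tau>)\<^sup>+"
    by (metis trancl_mono_subset trancl_id trans_trancl)
qed

lemma happens_before_bound: "(i, j) \<in> happens_before \<tau> \<Longrightarrow> i < length \<tau> \<and> j < length \<tau>"
  by (auto simp: happens_before_def po_def cf_def same_action_def)

lemma happens_before_id_edges:
  "(i, j) \<in> (happens_before \<tau>)\<^sup>* \<Longrightarrow> (ev_id \<tau> i, ev_id \<tau> j) \<in> (id_edges \<tau>)\<^sup>*"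
proof (induction rule: rtrancl_induct)
  case (step j k)
  have "(ev_id \<tau> j, ev_id \<tau> k) \<in> (id_edges \<tau>)\<^sup>*"
    using step.hyps(2) edge_id_edges[of j k \<tau>] by (auto simp: happens_before_def same_action_def)
  with step.IH show ?case by (rule rtrancl_trans)
qed simp

section \<open>Cycles as lists and as closed paths\<close>

lemma path_rtrancl:
  "set (zip xs (tl xs)) \<subseteq> R \<Longrightarrow> xs \<noteq> [] \<Longrightarrow> x \<in> set xs \<Longrightarrow> (hd xs, x) \<in> R\<^sup>* \<and> (x, last xs) \<in> R\<^sup>*"
proof (induction xs arbitrary: x rule: induct_list012)
  case (3 y z zs)
  then have "(y, z) \<in> R" "(z, last (z # zs)) \<in> R\<^sup>*" by auto
  with 3 show ?case by (auto intro: converse_rtrancl_into_rtrancl)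
qed auto

lemma rtrancl_path:
  "(x, y) \<in> R\<^sup>* \<Longrightarrow> \<exists>xs. xs \<noteq> [] \<and> hd xs = x \<and> last xs = y \<and> set (zip xs (tl xs)) \<subseteq> R"
proof (induction rule: converse_rtrancl_induct)
  case base
  show ?case by (intro exI[of _ "[y]"]) simp
next
  case (step x z)
  then obtain xs where "xs \<noteq> []" "hd xs = z" "last xs = y" "set (zip xs (tl xs)) \<subseteq> R" by blast
  with step.hyps(1) show ?case by (intro exI[of _ "x # xs"]) (cases xs; auto)
qed

lemma cycle_edges_eq:
  assumes "xs \<noteq> []"
  shows "cycle_edges xs = insert (last xs, hd xs) (set (zip xs (tl xs)))"
proof -
  obtain y ys where xs: "xs = y # ys" using assms by (cases xs) auto
  have "zip (y # ys) (ys @ [z]) = zip (y # ys) ys @ [(last (y # ys), z)]" for z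
    by (induction ys arbitrary: y) auto
  with xs show ?thesis by (simp add: cycle_edges_def)
qed

text \<open>Inside a class of \<open>same_action\<close> every position reaches every other, and an
  edge outside \<open>same_action\<close> joins two different classes. So violating cycles of
  positions correspond to cycles between classes, that is, between identifiers.\<close>

lemma violating_iff: "violating \<tau> \<longleftrightarrow> \<not> acyclic (id_order \<tau>)"
proof -
  have "violating \<tau> \<longleftrightarrow>
    (\<exists>i j. (i, j) \<in> happens_before \<tau> - same_action \<tau> \<and> (j, i) \<in> (happens_before \<tau>)\<^sup>*)"
  proof
    assume "violating \<tau>"
    then obtain xs i j where xs: "xs \<noteq> []" "cycle_edges xs \<subseteq> happens_before \<tau>"
      and ij: "(i, j) \<in> cycle_edges xs" "(i, j) \<notin> same_action \<tau>"
      by (auto simp: violating_def is_cycle_def)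
    have "i \<in> set xs" "j \<in> set xs"
      using ij(1) by (auto simp: cycle_edges_def dest: set_zip_leftD set_zip_rightD)
    then have "(hd xs, i) \<in> (happens_before \<tau>)\<^sup>*" "(j, last xs) \<in> (happens_before \<tau>)\<^sup>*"
      using path_rtrancl[of xs "happens_before \<tau>"] xs by (auto simp: cycle_edges_eq)
    moreover have "(last xs, hd xs) \<in> happens_before \<tau>" using xs by (auto simp: cycle_edges_eq)
    ultimately have "(j, i) \<in> (happens_before \<tau>)\<^sup>*" by (meson converse_rtrancl_into_rtrancl rtrancl_trans)
    with ij xs show "\<exists>i j. (i, j) \<in> happens_before \<tau> - same_action \<tau> \<and> (j, i) \<in> (happens_before \<tau>)\<^sup>*"
      by blast
  next
    assume "\<exists>i j. (i, j) \<in> happens_before \<tau> - same_action \<tau> \<and> (j, i) \<in> (happens_before \<tau>)\<^sup>*"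
    then obtain i j where ij: "(i, j) \<in> happens_before \<tau>" "(i, j) \<notin> same_action \<tau>"
      "(j, i) \<in> (happens_before \<tau>)\<^sup>*" by blast
    then obtain xs where "xs \<noteq> []" "hd xs = j" "last xs = i" "set (zip xs (tl xs)) \<subseteq> happens_before \<tau>"
      using rtrancl_path by meson
    then show "violating \<tau>"
      using ij(1,2) by (auto simp: violating_def is_cycle_def cycle_edges_eq intro!: exI[of _ xs])
  qed
  also have "\<dots> \<longleftrightarrow> \<not> acyclic (id_edges \<tau>)"
  proof
    assume "\<exists>i j. (i, j) \<in> happens_before \<tau> - same_action \<tau> \<and> (j, i) \<in> (happens_before \<tau>)\<^sup>*"
    then obtain i j where ij: "(i, j) \<in> happens_before \<tau>" "(i, j) \<notin> same_action \<tau>"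
      "(j, i) \<in> (happens_before \<tau>)\<^sup>*" by blast
    then have "(i, j) \<in> po \<tau> \<union> cf \<tau>" "i \<noteq> j" by (auto simp: happens_before_def po_def cf_def)
    moreover then have "ev_id \<tau> i \<noteq> ev_id \<tau> j"
      using ij(2) happens_before_bound[OF ij(1)] by (auto simp: same_action_def)
    ultimately have "(ev_id \<tau> i, ev_id \<tau> j) \<in> id_edges \<tau>" by (auto simp: id_edges_def)
    then show "\<not> acyclic (id_edges \<tau>)"
      using happens_before_id_edges[OF ij(3)] by (meson acyclic_def rtrancl_into_trancl2)
  next
    \<comment> \<open>Where two consecutive identifier edges do not meet in the same position, a
      \<open>same_action\<close> step bridges the gap.\<close>
    have lift: "\<exists>j'. j' < length \<tau> \<and> ev_id \<tau> j' = b \<and> (j, j') \<in> (happens_before \<tau>)\<^sup>*"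
      if "(a, b) \<in> (id_edges \<tau>)\<^sup>*" "j < length \<tau>" "ev_id \<tau> j = a" for a b j
      using that
    proof (induction rule: rtrancl_induct)
      case (step b c)
      then obtain k where k: "k < length \<tau>" "ev_id \<tau> k = b" "(j, k) \<in> (happens_before \<tau>)\<^sup>*" by blast
      obtain u v where uv: "(u, v) \<in> happens_before \<tau>" "ev_id \<tau> u = b" "ev_id \<tau> v = c"
        using step.hyps(2) by (auto simp: id_edges_def happens_before_def)
      have "(k, u) \<in> (happens_before \<tau>)\<^sup>*"
        using k uv happens_before_bound[OF uv(1)]
        by (cases "k = u") (auto simp: happens_before_def same_action_def intro!: r_into_rtrancl)
      then have "(j, v) \<in> (happens_before \<tau>)\<^sup>*"
        using k(3) uv(1) by (meson rtrancl_trans rtrancl_into_rtrancl)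
      with uv show ?case using happens_before_bound[OF uv(1)] by blast
    qed auto
    assume "\<not> acyclic (id_edges \<tau>)"
    then obtain a b where "(a, b) \<in> id_edges \<tau>" and ba: "(b, a) \<in> (id_edges \<tau>)\<^sup>*"
      by (auto simp: acyclic_def dest: tranclD)
    then obtain i j where ij: "(i, j) \<in> po \<tau> \<union> cf \<tau>" "ev_id \<tau> i = a" "ev_id \<tau> j = b" "a \<noteq> b"
      by (auto simp: id_edges_def)
    then have hb: "(i, j) \<in> happens_before \<tau> - same_action \<tau>"
      by (auto simp: happens_before_def same_action_def)
    then have bnd: "i < length \<tau>" "j < length \<tau>" using happens_before_bound by auto
    from lift[OF ba bnd(2) ij(3)] obtain k where
      k: "k < length \<tau>" "ev_id \<tau> k = a" "(j, k) \<in> (happens_before \<tau>)\<^sup>*" by blast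
    have "(k, i) \<in> (happens_before \<tau>)\<^sup>*"
      using k ij bnd
      by (cases "k = i") (auto simp: happens_before_def same_action_def intro!: r_into_rtrancl)
    with k(3) hb show "\<exists>i j. (i, j) \<in> happens_before \<tau> - same_action \<tau> \<and> (j, i) \<in> (happens_before \<tau>)\<^sup>*"
      by (meson rtrancl_trans)
  qed
  also have "\<dots> \<longleftrightarrow> \<not> acyclic (id_order \<tau>)"
    by (simp add: acyclic_def id_edges_trancl)
  finally show ?thesis .
qed

lemma id_order_context:
  "id_order ys = id_order zs \<Longrightarrow> set ys = set zs \<Longrightarrow> id_order (us @ ys @ ws) = id_order (us @ zs @ ws)"
  by (simp only: id_order_append set_append)

lemma id_order_infix: "id_order ys \<subseteq> id_order (us @ ys @ ws)"
  by (simp only: id_order_append) blast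

subsection \<open>Sorting a part of a run\<close>

text \<open>The invariant of the exchanges: the fixed final state keeps the queues empty at the end,
  the fixed \<open>id_order\<close> keeps the violation, and the order condition keeps pops of one
  queue from being exchanged.\<close>

definition arrangement :: "('c, 'r) program_code \<Rightarrow> nat \<Rightarrow> (nat \<Rightarrow> nat) \<Rightarrow> (nat \<times> nat) set \<Rightarrow>
    ('c, 'r) state \<Rightarrow> tagged_event list list \<Rightarrow> bool" where
  "arrangement P N f R s bs \<longleftrightarrow>
     blocks P N bs s \<and> sorted_wrt (program_ordered f) bs \<and> id_order (concat bs) = R"

definition consistent :: "(nat \<Rightarrow> nat) \<Rightarrow> tagged_event list \<Rightarrow> tagged_event list \<Rightarrow> bool" where
  "consistent f b b' \<longleftrightarrow>
     (f (tag b') < f (tag b) \<longrightarrow> (\<forall>e \<in> set b. \<forall>e' \<in> set b'. \<not> dependent e e'))"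

lemma arrangement_swap:
  assumes arr: "arrangement P N f R s (us @ x # y # ws)" and less: "f (tag y) < f (tag x)"
    and "consistent f x y"
  shows "arrangement P N f R s (us @ y # x # ws)"
proof -
  have indep: "\<forall>e \<in> set x. \<forall>e' \<in> set y. \<not> dependent e e'" using assms by (simp add: consistent_def)
  have bl: "blocks P N (us @ x # y # ws) s" and po: "sorted_wrt (program_ordered f) (us @ x # y # ws)"
    and R: "id_order (concat (us @ x # y # ws)) = R"
    using arr by (simp_all add: arrangement_def)
  have "blocks P N (us @ y # x # ws) s"
    using blocks_swap[OF bl _ less indep] po by (simp add: sorted_wrt_append)
  moreover have "program_ordered f y x"
    unfolding program_ordered_def
    using less blocks_uniform[OF bl, of x] blocks_uniform[OF bl, of y] by fastforce
  then have "sorted_wrt (program_ordered f) (us @ y # x # ws)"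
    using po by (auto simp: sorted_wrt_append)
  moreover have "\<forall>e \<in> set y. \<forall>e' \<in> set x. \<not> dependent e e'" using indep dependent_sym by blast
  with indep have "id_order (x @ y) = id_order (y @ x)"
    unfolding id_order_append by blast
  then have "id_order (concat us @ (y @ x) @ concat ws) = id_order (concat us @ (x @ y) @ concat ws)"
    by (intro id_order_context) auto
  then have "id_order (concat (us @ y # x # ws)) = R" using R by simp
  ultimately show ?thesis by (simp add: arrangement_def)
qed

lemma arrangement_insort:
  "arrangement P N f R s (us @ x # bs @ ws) \<Longrightarrow> \<forall>b \<in> set bs. consistent f x b \<Longrightarrow>
   arrangement P N f R s (us @ insort_key (\<lambda>b. f (tag b)) x bs @ ws)"
proof (induction bs arbitrary: us)
  case (Cons b bs)
  show ?case
  proof (cases "f (tag x) \<le> f (tag b)")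
    case True
    with Cons.prems show ?thesis by simp
  next
    case False
    then have "arrangement P N f R s ((us @ [b]) @ x # bs @ ws)"
      using arrangement_swap[of P N f R s us x b "bs @ ws"] Cons.prems by simp
    from Cons.IH[OF this] False Cons.prems(2) show ?thesis by simp
  qed
qed simp

text \<open>\<open>sort_key\<close> is insertion sort and thus a series of adjacent exchanges. Being
  stable, it exchanges only pairs that descend under \<open>f\<close>, and \<open>consistent\<close>
  makes exactly these independent.\<close>

lemma arrangement_sort:
  "arrangement P N f R s (us @ bs @ ws) \<Longrightarrow> sorted_wrt (consistent f) bs \<Longrightarrow>
   arrangement P N f R s (us @ sort_key (\<lambda>b. f (tag b)) bs @ ws)"
proof (induction bs arbitrary: us)
  case (Cons b bs)
  from Cons.IH[of "us @ [b]"] Cons.prems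
  have "arrangement P N f R s (us @ b # sort_key (\<lambda>b. f (tag b)) bs @ ws)" by simp
  with Cons.prems(2) show ?case by (simp add: arrangement_insort)
qed simp

subsection \<open>Erasing the last command\<close>

fun without_value :: "nat \<times> rank \<times> nat \<times> nat \<Rightarrow> nat \<times> rank \<times> nat" where
  "without_value (i, rd, ad, v) = (i, rd, ad)"

text \<open>Pops are enabled by the queues alone and their events contain no values, so the two runs
  may differ in \<open>sc\<close>, in \<open>mem\<close> and in the values held in
  \<open>vq\<close>.\<close>

definition erased :: "nat \<Rightarrow> ('c, 'r) state \<Rightarrow> ('c, 'r) state \<Rightarrow> bool" where
  "erased a s s' \<longleftrightarrow> (\<forall>rq. pq s' rq = filter (\<lambda>e. fst e \<noteq> a) (pq s rq) \<and>
     map without_value (vq s' rq) = map without_value (filter (\<lambda>e. fst e \<noteq> a) (vq s rq)))"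

text \<open>A head that is not erased is also the head of the filtered queue, so the same pop is
  enabled there. A pop of the erased action is matched by standing still.\<close>

lemma erased_step:
  assumes "step P N n s es t" and "\<forall>e \<in> set es. pops e" and "es \<noteq> []" and "erased a s s'"
  shows "if tag es = a then erased a t s' else \<exists>t'. step P N n s' es t' \<and> erased a t t'"
  using assms(1)
proof (cases rule: step_cases)
  case (command e)
  with assms(2) show ?thesis by simp
next
  case (pop_a rq i rs as rd ad l)
  show ?thesis
  proof (cases "i = a")
    case True
    with pop_a assms(4) show ?thesis by (auto simp: erased_def simp del: split_paired_All)
  next
    case False
    obtain r q where rq: "rq = (r, q)" by (cases rq)
    have "pq s' (r, q) = (i, rs, as, rd, ad) # filter (\<lambda>e. fst e \<noteq> a) l"
      using assms(4) pop_a(2) False rq by (simp add: erased_def)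
    from step.pop_a[OF _ this, of N P n] pop_a rq have
      "step P N n s' es (s'\<lparr>pq := (pq s')(rq := filter (\<lambda>e. fst e \<noteq> a) l),
        vq := (vq s')(rq := vq s' rq @ [(i, rd, ad, mem s' (rs, Adr as))])\<rparr>)" by simp
    moreover have "erased a t (s'\<lparr>pq := (pq s')(rq := filter (\<lambda>e. fst e \<noteq> a) l),
        vq := (vq s')(rq := vq s' rq @ [(i, rd, ad, mem s' (rs, Adr as))])\<rparr>)"
      using assms(4) pop_a(4) False by (auto simp: erased_def simp del: split_paired_All)
    ultimately show ?thesis using pop_a(3) False by auto
  qed
next
  case (pop_b rq i rd ad v l)
  show ?thesis
  proof (cases "i = a")
    case True
    with pop_b assms(4) show ?thesis by (auto simp: erased_def simp del: split_paired_All)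
  next
    case False
    obtain r q where rq: "rq = (r, q)" by (cases rq)
    have "map without_value (vq s' rq) =
      (i, rd, ad) # map without_value (filter (\<lambda>e. fst e \<noteq> a) l)"
      using assms(4) pop_b(2) False by (simp add: erased_def del: split_paired_All)
    then obtain v' l' where l': "vq s' (r, q) = (i, rd, ad, v') # l'"
      "map without_value l' = map without_value (filter (\<lambda>e. fst e \<noteq> a) l)"
      unfolding map_eq_Cons_conv rq by (metis Pair_inject without_value.cases without_value.simps)
    from step.pop_b[OF _ l'(1), of N P n] pop_b rq have
      "step P N n s' es (s'\<lparr>vq := (vq s')(rq := l'), mem := (mem s')((rd, Adr ad) := v')\<rparr>)" by simp
    moreover have "erased a t (s'\<lparr>vq := (vq s')(rq := l'), mem := (mem s')((rd, Adr ad) := v')\<rparr>)"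
      using assms(4) pop_b(4) False l'(2) by (auto simp: erased_def simp del: split_paired_All)
    ultimately show ?thesis using pop_b(3) False by auto
  qed
next
  case (barrier c)
  with assms(2,3) show ?thesis by (auto simp del: upt_Suc)
qed

lemma step_command_queues:
  assumes "step P N n s es s'" and "\<not> (\<forall>e \<in> set es. pops e)"
  shows "vq s' = vq s" and "filter (\<lambda>e. fst e \<noteq> n) (pq s' rq) = filter (\<lambda>e. fst e \<noteq> n) (pq s rq)"
  using assms by (cases; simp)+

text \<open>An entry in \<open>pq\<close> still has to be popped twice, an entry in \<open>vq\<close> once.\<close>

definition unsettled :: "nat \<Rightarrow> nat \<Rightarrow> ('c, 'r) state \<Rightarrow> bool" where
  "unsettled a k s \<longleftrightarrow> (\<exists>rq. (\<forall>rq'. rq' \<noteq> rq \<longrightarrow> a \<notin> set (pending s rq')) \<and>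
     2 * length (filter (\<lambda>e. fst e = a) (pq s rq)) + length (filter (\<lambda>e. fst e = a) (vq s rq)) \<le> k)"

text \<open>At most one entry is issued, and it has both of its pops ahead: hence the 2.\<close>

lemma unsettled_command:
  assumes "step P N n s es s'" and "\<not> (\<forall>e \<in> set es. pops e)" and fresh: "\<And>rq. n \<notin> set (pending s rq)"
  shows "unsettled n 2 s'"
proof -
  have z: "filter (\<lambda>e. fst e = n) (pq s rq) = []" "filter (\<lambda>e. fst e = n) (vq s rq) = []" for rq
    using fresh[of rq] by (auto simp: pending_def filter_empty_conv)
  have vq: "vq s' = vq s" using step_command_queues(1)[OF assms(1,2)] .
  have "\<exists>rq. (\<forall>rq'. rq' \<noteq> rq \<longrightarrow> pq s' rq' = pq s rq') \<and>
    (\<exists>xs. pq s' rq = pq s rq @ xs \<and> length xs \<le> 1)"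
    using assms(1,2)
  proof cases
    case (read r la rr ra q c)
    then show ?thesis by (intro exI[of _ "(r, val s r q)"]) simp
  next
    case ("write" r la rr ra q c)
    then show ?thesis by (intro exI[of _ "(r, val s r q)"]) simp
  qed auto
  then obtain rq xs where rq: "\<And>rq'. rq' \<noteq> rq \<Longrightarrow> pq s' rq' = pq s rq'" "pq s' rq = pq s rq @ xs"
    "length xs \<le> 1" by blast
  have "length (filter (\<lambda>e. fst e = n) xs) \<le> 1" using rq(3) length_filter_le le_trans by blast
  then show ?thesis
    unfolding unsettled_def using rq(1,2) fresh vq z
    by (intro exI[of _ rq]) (simp add: pending_def)
qed

lemma unsettled_pop:
  assumes "step P N n s es s'" and "\<forall>e \<in> set es. pops e" and "es \<noteq> []" and "unsettled a k s"
  shows "if tag es = a then 0 < k \<and> unsettled a (k - 1) s' else unsettled a k s'"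
proof -
  obtain rq where rq: "\<And>rq'. rq' \<noteq> rq \<Longrightarrow> a \<notin> set (pending s rq')"
    and k: "2 * length (filter (\<lambda>e. fst e = a) (pq s rq)) + length (filter (\<lambda>e. fst e = a) (vq s rq)) \<le> k"
    using assms(4) unfolding unsettled_def by blast
  have other: "a \<notin> set (pending s' rq')" if "rq' \<noteq> rq" for rq'
    using step_pending[OF assms(1), of rq'] assms(2) rq[OF that] set_tl_subset[of "pending s rq'"]
    by auto
  show ?thesis
    using assms(1)
  proof (cases rule: step_cases)
    case (command e)
    with assms(2) show ?thesis by simp
  next
    case (pop_a rq' i rs as rd ad l)
    then have "rq' = rq" if "i = a" using rq[of rq'] that by (auto simp: pending_def)
    with pop_a k other show ?thesis
      by (auto simp: unsettled_def simp del: split_paired_All split_paired_Ex intro!: exI[of _ rq])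
  next
    case (pop_b rq' i rd ad v l)
    then have "rq' = rq" if "i = a" using rq[of rq'] that by (auto simp: pending_def)
    with pop_b k other show ?thesis
      by (auto simp: unsettled_def simp del: split_paired_All split_paired_Ex intro!: exI[of _ rq])
  next
    case (barrier c)
    with assms(2,3) show ?thesis by (auto simp del: upt_Suc)
  qed
qed

text \<open>One induction over the trailing pops serves all three claims: each pop is either copied
  to the run without \<open>b\<close> or handles the entry of \<open>b\<close>, and
  \<open>unsettled\<close> limits how often the latter happens.\<close>

lemma last_command:
  assumes "blocks P N (us @ b # ws) s" and "\<not> (\<forall>e \<in> set b. pops e)"
    and "\<forall>w \<in> set ws. \<forall>e \<in> set w. pops e"
  shows "tag b \<notin> snd ` set (concat us)"
    and "\<exists>s'. blocks P N (us @ filter (\<lambda>w. tag w \<noteq> tag b) ws) s' \<and> erased (tag b) s s'"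
    and "length (filter (\<lambda>w. tag w = tag b) ws) \<le> 2"
proof -
  have "tag b \<notin> snd ` set (concat us) \<and>
    (\<exists>s'. blocks P N (us @ filter (\<lambda>w. tag w \<noteq> tag b) ws) s' \<and> erased (tag b) s s') \<and>
    (\<exists>k. unsettled (tag b) k s \<and> length (filter (\<lambda>w. tag w = tag b) ws) + k \<le> 2)"
    using assms(1,3)
  proof (induction ws arbitrary: s rule: rev_induct)
    case Nil
    then obtain s0 n where s0: "blocks P N us s0" "n \<notin> snd ` set (concat us)"
      and step: "step P N n s0 b s" "b \<noteq> []" by (auto simp: blocks_snoc)
    have n: "tag b = n" using step_block[OF step] assms(2) step(2) by (metis list.set_sel(1) tag_def)
    have fresh: "n \<notin> set (pending s0 rq)" for rq
      using pending_origin[OF s0(1), of n rq] s0(2) by force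
    have id: "filter (\<lambda>e. fst e \<noteq> n) (pq s0 rq) = pq s0 rq"
      "filter (\<lambda>e. fst e \<noteq> n) (vq s0 rq) = vq s0 rq" for rq
      using fresh[of rq] by (auto simp: pending_def filter_id_conv)
    \<comment> \<open>The state before \<open>b\<close> simulates the one after it: a command leaves
      \<open>vq\<close> alone and adds to \<open>pq\<close> only entries with its own fresh
      identifier.\<close>
    have "erased n s s0"
      using step_command_queues[OF step(1) assms(2)] id by (simp add: erased_def)
    with unsettled_command[OF step(1) assms(2) fresh] s0 n show ?case by auto
  next
    case (snoc w ws)
    from snoc.prems obtain t n where t: "blocks P N (us @ b # ws) t"
      and fresh: "n \<notin> snd ` set (concat (us @ b # ws))" and step: "step P N n t w s" "w \<noteq> []"
      using blocks_snoc[of P N "us @ b # ws" w s] by auto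
    have pops: "\<forall>e \<in> set w. pops e" using snoc.prems(2) by simp
    obtain t' k where us: "tag b \<notin> snd ` set (concat us)"
      and t': "blocks P N (us @ filter (\<lambda>w. tag w \<noteq> tag b) ws) t'" "erased (tag b) t t'"
      and k: "unsettled (tag b) k t" "length (filter (\<lambda>w. tag w = tag b) ws) + k \<le> 2"
      using snoc.IH[OF t] snoc.prems(2) by auto
    have "\<exists>k. unsettled (tag b) k s \<and> length (filter (\<lambda>w. tag w = tag b) (ws @ [w])) + k \<le> 2"
      using unsettled_pop[OF step(1) pops step(2) k(1)] k(2) by (auto split: if_splits)
    moreover have
      "\<exists>s'. blocks P N (us @ filter (\<lambda>w. tag w \<noteq> tag b) (ws @ [w])) s' \<and> erased (tag b) s s'"
    proof (cases "tag w = tag b")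
      case True
      with erased_step[OF step(1) pops step(2) t'(2)] t'(1) show ?thesis by auto
    next
      case False
      with erased_step[OF step(1) pops step(2) t'(2)] obtain s' where
        s': "step P N n t' w s'" "erased (tag b) s s'" by auto
      have "n \<notin> snd ` set (concat (us @ filter (\<lambda>w. tag w \<noteq> tag b) ws))" using fresh by auto
      with t'(1) s'(1) step(2) have
        "blocks P N ((us @ filter (\<lambda>w. tag w \<noteq> tag b) ws) @ [w]) s'" unfolding blocks_snoc by blast
      with False s'(2) show ?thesis by auto
    qed
    ultimately show ?case using us by blast
  qed
  then show "tag b \<notin> snd ` set (concat us)"
    and "\<exists>s'. blocks P N (us @ filter (\<lambda>w. tag w \<noteq> tag b) ws) s' \<and> erased (tag b) s s'"
    and "length (filter (\<lambda>w. tag w = tag b) ws) \<le> 2" by auto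
qed

lemma blocks_all_pops: "blocks P N bs s \<Longrightarrow> \<forall>b \<in> set bs. \<forall>e \<in> set b. pops e \<Longrightarrow> bs = []"
proof (induction rule: blocks.induct)
  case (extend bs s n es s')
  then have "s = initial_state P" "\<forall>e \<in> set es. pops e" by (auto simp: blocks_Nil)
  with extend.hyps(3,4) have False
    by (cases rule: step_cases) (auto simp: initial_state_def simp del: upt_Suc)
  then show ?case ..
qed simp

section \<open>Cutting a list behind its marked elements\<close>

lemma sorted_wrt_vacuous: "\<forall>x \<in> set xs. \<not> p x \<Longrightarrow> sorted_wrt (\<lambda>x y. p x \<longrightarrow> q y) xs"
  by (induction xs) auto

text \<open>The condition on \<open>ys\<close> says that elements with \<open>p\<close> occur only
  at its end. Truncated subtraction covers the case that there are none.\<close>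

lemma split_after_first:
  "\<exists>ys zs. xs = ys @ zs \<and> sorted_wrt (\<lambda>x y. p x \<longrightarrow> p y) ys \<and>
     length (filter p zs) \<le> length (filter p xs) - 1"
proof (cases "\<exists>x \<in> set xs. p x")
  case True
  then obtain ys x zs where "xs = ys @ x # zs" "p x" "\<forall>y \<in> set ys. \<not> p y"
    using split_list_first_prop[of xs p] by blast
  then show ?thesis
    by (intro exI[of _ "ys @ [x]"] exI[of _ zs]) (auto simp: sorted_wrt_append sorted_wrt_vacuous)
next
  case False
  then show ?thesis by (intro exI[of _ xs] exI[of _ "[]"]) (auto intro: sorted_wrt_vacuous)
qed

lemma split_three:
  assumes "length (filter p xs) \<le> 2"
  obtains ys zs ws where "xs = ys @ zs @ ws"
    "\<forall>vs \<in> {ys, zs, ws}. sorted_wrt (\<lambda>x y. p x \<longrightarrow> p y) vs"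
proof -
  obtain ys xs' where 1: "xs = ys @ xs'" "sorted_wrt (\<lambda>x y. p x \<longrightarrow> p y) ys" "length (filter p xs') \<le> 1"
    using split_after_first[of xs p] assms by force
  obtain zs ws where 2: "xs' = zs @ ws" "sorted_wrt (\<lambda>x y. p x \<longrightarrow> p y) zs" "length (filter p ws) \<le> 0"
    using split_after_first[of xs' p] 1 by force
  have "sorted_wrt (\<lambda>x y. p x \<longrightarrow> p y) ws"
    using 2(3) by (auto simp: filter_empty_conv intro: sorted_wrt_vacuous)
  with 1 2 that show thesis by auto
qed

subsection \<open>Sorted parts and normal form\<close>

text \<open>By acyclicity the number of predecessors under \<open>R\<^sup>+\<close> grows strictly
  along \<open>R\<close>. Scaling it by a strict bound \<open>m\<close> of \<open>S\<close> makes
  room for a tie-breaker.\<close>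

lemma linear_extension:
  fixes R :: "(nat \<times> nat) set"
  assumes "finite S" and "acyclic R" and "R \<subseteq> S \<times> S"
  shows "\<exists>f :: nat \<Rightarrow> nat. inj_on f S \<and> (\<forall>i j. (i, j) \<in> R \<longrightarrow> f i < f j)"
proof -
  obtain m where m: "\<And>i. i \<in> S \<Longrightarrow> i < m" using assms(1) by (auto simp: finite_nat_set_iff_bounded)
  define g where "g i = card {j \<in> S. (j, i) \<in> R\<^sup>+}" for i
  define f where "f i = g i * m + i" for i \<comment> \<open>the summand \<open>i < m\<close> only makes \<open>f\<close> injective\<close>
  have "f i mod m = i" if "i \<in> S" for i using m[OF that] by (simp add: f_def)
  then have "inj_on f S" by (rule inj_on_inverseI)
  moreover have "f i < f j" if "(i, j) \<in> R" for i j
  proof -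
    have ij: "i \<in> S" "j \<in> S" using that assms(3) by auto
    have "{k \<in> S. (k, i) \<in> R\<^sup>+} \<subset> {k \<in> S. (k, j) \<in> R\<^sup>+}"
      using that ij assms(2) by (auto simp: acyclic_def intro: trancl_into_trancl)
    then have "g i < g j" unfolding g_def using assms(1) by (intro psubset_card_mono) auto
    then have "Suc (g i) * m \<le> g j * m" by (intro mult_le_mono1) simp
    then show ?thesis using m[OF ij(1)] by (simp add: f_def)
  qed
  ultimately show ?thesis by blast
qed

lemma linear_extension_top:
  fixes R :: "(nat \<times> nat) set"
  assumes "finite S" and "acyclic R" and "R \<subseteq> S \<times> S" and "a \<notin> S"
  shows "\<exists>f :: nat \<Rightarrow> nat. inj_on f (insert a S) \<and> (\<forall>i j. (i, j) \<in> R \<longrightarrow> f i < f j) \<and> (\<forall>i \<in> S. f i < f a)"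
proof -
  obtain g :: "nat \<Rightarrow> nat" where g: "inj_on g S" "\<And>i j. (i, j) \<in> R \<Longrightarrow> g i < g j"
    using linear_extension[OF assms(1-3)] by blast
  \<comment> \<open>For empty \<open>S\<close> the maximum is unspecified, but then there is nothing
    to compare with \<open>f a\<close>.\<close>
  define f where "f = g(a := Suc (Max (g ` S)))"
  have f_g: "f i = g i" if "i \<in> S" for i using that assms(4) by (auto simp: f_def)
  have less: "f i < f a" if "i \<in> S" for i
    using that assms(1) by (simp add: f_g) (simp add: f_def less_Suc_eq_le)
  have "inj_on f S" using g(1) f_g inj_on_cong by metis
  moreover have "f a \<notin> f ` S" using less by force
  ultimately have "inj_on f (insert a S)" using assms(4) by simp
  moreover have "f i < f j" if "(i, j) \<in> R" for i j
    using g(2)[OF that] that assms(3) f_g by auto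
  ultimately show ?thesis using less by blast
qed

lemma sorted_part:
  assumes "sorted (map (\<lambda>e. f (snd e)) t)" and "i \<in> {length u..<length u + length t}"
    and "j \<in> {length u..<length u + length t}"
    and "f (ev_id (u @ t @ w) i) < f (ev_id (u @ t @ w) j)"
  shows "i < j"
proof (rule ccontr)
  assume "\<not> i < j"
  then have "map (\<lambda>e. f (snd e)) t ! (j - length u) \<le> map (\<lambda>e. f (snd e)) t ! (i - length u)"
    using assms(2,3) by (intro sorted_nth_mono[OF assms(1)]) auto
  moreover have "ev_id (u @ t @ w) k = snd (t ! (k - length u))"
    if "k \<in> {length u..<length u + length t}" for k
    using that by (auto simp: ev_id_def nth_append)
  moreover have "i - length u < length t" "j - length u < length t" using assms(2,3) by auto
  ultimately show False using assms(2-4) by simp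
qed

lemma same_action_rtrancl: "(i, j) \<in> (same_action \<tau>)\<^sup>* \<Longrightarrow> ev_id \<tau> i = ev_id \<tau> j"
  by (induction rule: rtrancl_induct) (auto simp: same_action_def)

text \<open>Injectivity of \<open>f\<close> gives different actions different values. Their order in
  \<open>t1\<close> therefore fixes a strict inequality, which sortedness carries over to each of
  the parts.\<close>

lemma normal_formI:
  assumes inj: "inj_on f (snd ` set (t1 @ t2 @ t3 @ t4))"
    and srt: "\<forall>t \<in> {t1, t2, t3, t4}. sorted (map (\<lambda>e. f (snd e)) t)"
    and pops: "\<forall>e \<in> set (t2 @ t3 @ t4). pops e"
  shows "normal_form (t1 @ t2 @ t3 @ t4)"
proof -
  define \<tau> where "\<tau> = t1 @ t2 @ t3 @ t4"
  define n1 n2 n3 where n: "n1 = length t1" "n2 = n1 + length t2" "n3 = n2 + length t3"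
  have part: "i < j" if "B \<in> {{0..<n1}, {n1..<n2}, {n2..<n3}, {n3..<length \<tau>}}" "i \<in> B" "j \<in> B"
    "f (ev_id \<tau> i) < f (ev_id \<tau> j)" for B i j
  proof -
    from that(1) consider "B = {0..<n1}" | "B = {n1..<n2}" | "B = {n2..<n3}" | "B = {n3..<length \<tau>}"
      by blast
    then show ?thesis
    proof cases
      case 1
      then show ?thesis
        using sorted_part[of f t1 i "[]" j "t2 @ t3 @ t4"] that(2-) srt by (simp add: \<tau>_def n)
    next
      case 2
      then show ?thesis
        using sorted_part[of f t2 i t1 j "t3 @ t4"] that(2-) srt by (simp add: \<tau>_def n)
    next
      case 3
      then show ?thesis
        using sorted_part[of f t3 i "t1 @ t2" j t4] that(2-) srt by (simp add: \<tau>_def n)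
    next
      case 4
      then show ?thesis
        using sorted_part[of f t4 i "t1 @ t2 @ t3" j "[]"] that(2-) srt by (simp add: \<tau>_def n add.assoc)
    qed
  qed
  have pop: "is_pop \<tau> i" if "i \<in> {n1..<length \<tau>}" for i
  proof -
    have "\<tau> ! i = (t2 @ t3 @ t4) ! (i - n1)" "i - n1 < length (t2 @ t3 @ t4)"
      using that by (auto simp: \<tau>_def n nth_append[of t1])
    then have "\<tau> ! i \<in> set (t2 @ t3 @ t4)" by (simp only: nth_mem)
    then have "pops (\<tau> ! i)" using pops by blast
    then show ?thesis by (cases "\<tau> ! i" rule: pops.cases) (simp add: is_pop_def ev_kind_def)
  qed
  have order: "a' < b'"
    if ab: "a < b" "b < n1" "(a, b) \<notin> (same_action \<tau>)\<^sup>*"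
      and B: "B \<in> {{0..<n1}, {n1..<n2}, {n2..<n3}, {n3..<length \<tau>}}" "a' \<in> B" "b' \<in> B"
      and eq: "(a, a') \<in> (same_action \<tau>)\<^sup>*" "(b, b') \<in> (same_action \<tau>)\<^sup>*"
    for a b a' b' B
  proof -
    have bnd: "a < length \<tau>" "b < length \<tau>" using ab by (auto simp: \<tau>_def n)
    then have "ev_id \<tau> a \<noteq> ev_id \<tau> b" using ab by (auto simp: same_action_def)
    moreover have "ev_id \<tau> a \<in> snd ` set \<tau>" "ev_id \<tau> b \<in> snd ` set \<tau>"
      using bnd by (auto simp: ev_id_def)
    ultimately have "f (ev_id \<tau> a) \<noteq> f (ev_id \<tau> b)"
      using inj unfolding \<tau>_def[symmetric] by (meson inj_on_def)
    moreover have "\<not> f (ev_id \<tau> b) < f (ev_id \<tau> a)"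
      using part[of "{0..<n1}" b a] ab by auto
    ultimately have "f (ev_id \<tau> a') < f (ev_id \<tau> b')"
      using same_action_rtrancl[OF eq(1)] same_action_rtrancl[OF eq(2)] by simp
    with part B show ?thesis by blast
  qed
  have "normal_form \<tau>"
    unfolding normal_form_def
  proof (intro exI conjI)
    show "n1 \<le> n2" "n2 \<le> n3" "n3 \<le> length \<tau>" by (auto simp: \<tau>_def n)
    show "\<forall>i \<in> {n1..<length \<tau>}. is_pop \<tau> i" using pop by blast
  qed (intro ballI impI, rule order, simp_all only: atLeastLessThan_iff not_False_eq_True)
  then show ?thesis by (simp add: \<tau>_def)
qed

lemma sorted_concat:
  assumes "\<forall>b \<in> set bs. \<forall>e \<in> set b. snd e = tag b" and "sorted (map (\<lambda>b. f (tag b)) bs)"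
  shows "sorted (map (\<lambda>e. f (snd e)) (concat bs))"
  using assms
proof (induction bs)
  case (Cons b bs)
  have "map (\<lambda>e. f (snd e)) b = replicate (length b) (f (tag b))"
    using Cons.prems(1) by (intro replicate_eqI) auto
  then have "sorted (map (\<lambda>e. f (snd e)) b)" by (simp add: sorted_replicate)
  with Cons show ?case by (auto simp: sorted_append)
qed simp

lemma concat_filter_tag:
  "\<forall>b \<in> set bs. \<forall>e \<in> set b. snd e = tag b \<Longrightarrow>
   concat (filter (\<lambda>b. tag b \<noteq> a) bs) = filter (\<lambda>e. snd e \<noteq> a) (concat bs)"
proof (induction bs)
  case (Cons b bs)
  then have "filter (\<lambda>e. snd e \<noteq> a) b = (if tag b = a then [] else b)"
    by (auto simp: filter_empty_conv filter_id_conv)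
  with Cons show ?case by simp
qed simp

text \<open>Carries dependencies from events to whole steps, each represented by its tag.\<close>

lemma dependent_blocks_id_order:
  "\<forall>b \<in> set bs. \<forall>e \<in> set b. snd e = tag b \<Longrightarrow>
   sorted_wrt (\<lambda>b b'. (\<exists>e \<in> set b. \<exists>e' \<in> set b'. dependent e e') \<longrightarrow> (tag b, tag b') \<in> id_order (concat bs)) bs"
proof (induction bs)
  case (Cons b bs)
  have "(tag b, tag b') \<in> id_order (concat (b # bs))"
    if "b' \<in> set bs" "e \<in> set b" "e' \<in> set b'" "dependent e e'" for b' e e'
  proof -
    have "snd e = tag b" "snd e' = tag b'" using that Cons.prems by auto
    moreover have "e' \<in> set (concat bs)" using that by auto
    then have "(snd e, snd e') \<in> id_order (b @ concat bs)"
      using that(2,4) unfolding id_order_append by blast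
    ultimately show ?thesis by simp
  qed
  moreover have "id_order (concat bs) \<subseteq> id_order (concat (b # bs))" by (auto simp: id_order_append)
  ultimately show ?case using Cons by (auto intro: sorted_wrt_mono_rel[rotated])
qed simp

lemma ids_filter: "snd ` set (filter (\<lambda>e. snd e \<noteq> a) es) = snd ` set es - {a}"
  by (induction es) auto

section \<open>From a shortest violation to one in normal form\<close>

theorem theorem2:
  fixes D A Q :: "nat set" and Regs :: "'r set"
    and P :: "('c, 'r) program_code" and N :: nat
  assumes "finite D" and "0 \<in> D" and "finite A" and "0 \<in> A" and "finite Q" and "0 \<in> Q"
    and "finite Regs"
    and "pgas_program D A Q Regs P N"
  shows "robust P N \<longleftrightarrow> \<not> (\<exists>\<tau> \<in> computations P N. normal_form \<tau> \<and> violating \<tau>)"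
proof
  assume "robust P N"
  then show "\<not> (\<exists>\<tau> \<in> computations P N. normal_form \<tau> \<and> violating \<tau>)"
    by (auto simp: robust_def)
next
  have "\<exists>\<tau> \<in> computations P N. normal_form \<tau> \<and> violating \<tau>" if "\<not> robust P N"
  proof -
    obtain \<tau> where \<tau>: "\<tau> \<in> computations P N" "violating \<tau>"
      and least: "\<And>\<sigma>. \<sigma> \<in> computations P N \<Longrightarrow> violating \<sigma> \<Longrightarrow> length \<tau> \<le> length \<sigma>"
    proof -
      obtain \<tau>' where "\<tau>' \<in> computations P N \<and> violating \<tau>'"
        using \<open>\<not> robust P N\<close> unfolding robust_def by blast
      from ex_has_least_nat[of "\<lambda>\<tau>. \<tau> \<in> computations P N \<and> violating \<tau>", OF this, of length]
      show thesis using that by blast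
    qed
    from \<tau>(1) obtain bs s where bs: "blocks P N bs s" and empty: "queues_empty s"
      and concat: "concat bs = \<tau>"
      unfolding computations_iff_blocks by blast
    have "bs \<noteq> []" using \<tau>(2) concat by (auto simp: violating_iff acyclic_def)
    then have "\<exists>b \<in> set bs. \<not> (\<forall>e \<in> set b. pops e)" using blocks_all_pops[OF bs] by blast
    then obtain us b ws where split: "bs = us @ b # ws" and b: "\<not> (\<forall>e \<in> set b. pops e)"
      and ws: "\<forall>w \<in> set ws. \<forall>e \<in> set w. pops e"
      using split_list_last_prop[of bs "\<lambda>b. \<not> (\<forall>e \<in> set b. pops e)"] by blast
    have unif: "\<forall>b \<in> set bs. \<forall>e \<in> set b. snd e = tag b" using blocks_uniform[OF bs] by blast
    define a where "a = tag b"
    note last = last_command[OF bs[unfolded split] b ws, folded a_def]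
    have us: "\<forall>u \<in> set us. tag u \<noteq> a"
    proof
      fix u assume "u \<in> set us"
      moreover from this have "hd u \<in> set u" using blocks_uniform[OF bs, of u] by (simp add: split)
      ultimately have "tag u \<in> snd ` set (concat us)" unfolding tag_def by auto
      with last(1) show "tag u \<noteq> a" by metis
    qed
    define \<sigma> where "\<sigma> = filter (\<lambda>e. snd e \<noteq> a) \<tau>"
    have "\<sigma> = concat (us @ filter (\<lambda>w. tag w \<noteq> a) ws)"
      using concat_filter_tag[OF unif, of a] us unfolding \<sigma>_def concat[symmetric]
      by (simp add: split a_def)
    moreover obtain s' where "blocks P N (us @ filter (\<lambda>w. tag w \<noteq> a) ws) s'" "erased a s s'"
      using last(2) by blast
    moreover from this(2) empty have "queues_empty s'" by (simp add: erased_def queues_empty_def)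
    ultimately have "\<sigma> \<in> computations P N" unfolding computations_iff_blocks by blast
    moreover have "length \<sigma> < length \<tau>"
    proof -
      obtain e where "e \<in> set b" using b by auto
      then have "e \<in> set \<tau>" "snd e = a" using unif concat by (auto simp: split a_def)
      then show ?thesis unfolding \<sigma>_def by (intro length_filter_less) auto
    qed
    ultimately have acyclic: "acyclic (id_order \<sigma>)" using least[of \<sigma>] by (auto simp: violating_iff)

    have "snd ` set \<sigma> = snd ` set \<tau> - {a}" unfolding \<sigma>_def by (rule ids_filter)
    then have a: "a \<notin> snd ` set \<sigma>" and ids: "snd ` set \<tau> \<subseteq> insert a (snd ` set \<sigma>)"
      by blast+
    obtain f :: "nat \<Rightarrow> nat" where f: "inj_on f (insert a (snd ` set \<sigma>))"
      and f_\<sigma>: "\<forall>i j. (i, j) \<in> id_order \<sigma> \<longrightarrow> f i < f j" and f_a: "\<forall>i \<in> snd ` set \<sigma>. f i < f a"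
      using linear_extension_top[OF finite_imageI[OF finite_set] acyclic id_order_subset a]
      by (elim exE conjE)
    have inj: "inj_on f (snd ` set \<tau>)" using f ids by (rule inj_on_subset)
    \<comment> \<open>Pairs ending in \<open>a\<close> ascend because \<open>a\<close> is on top;
      pairs avoiding \<open>a\<close> belong to \<open>id_order \<sigma>\<close>. Only pairs leaving
      \<open>a\<close> escape.\<close>
    have f_mono: "f i < f j" if ij: "(i, j) \<in> id_order \<tau>" "i \<noteq> a" for i j
    proof (cases "j = a")
      case True
      have "i \<in> snd ` set \<tau>" using ij(1) id_order_subset[of \<tau>] by blast
      then have "i \<in> snd ` set \<sigma>" using ids ij(2) by blast
      with True show ?thesis using f_a by blast
    next
      case False
      then have "(i, j) \<in> id_order \<sigma>" using ij by (simp add: \<sigma>_def id_order_filter)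
      with f_\<sigma> show ?thesis by blast
    qed

    \<comment> \<open>Inside each piece the steps tagged \<open>a\<close> come at the end; in
      \<open>us @ [b]\<close> this is \<open>b\<close> alone.\<close>
    obtain w1 w2 w3 where w: "ws = w1 @ w2 @ w3"
      and last_in: "\<forall>ts \<in> {w1, w2, w3}. sorted_wrt (\<lambda>x y. tag x = a \<longrightarrow> tag y = a) ts"
      using split_three[OF last(3)] by blast
    define parts where "parts = {us @ [b], w1, w2, w3}"
    have consistent: "sorted_wrt (consistent f) ts" if ts: "ts \<in> parts" for ts
    proof -
      have "sorted_wrt (\<lambda>x y. tag x = a \<longrightarrow> tag y = a) ts"
        using ts last_in us by (auto simp: parts_def sorted_wrt_append sorted_wrt_vacuous)
      moreover obtain xs ys where bs_ts: "bs = xs @ ts @ ys"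
      proof -
        have "bs = [] @ (us @ [b]) @ w1 @ w2 @ w3" "bs = (us @ [b]) @ w1 @ w2 @ w3"
          "bs = (us @ b # w1) @ w2 @ w3" "bs = (us @ b # w1 @ w2) @ w3 @ []"
          by (simp_all add: split w)
        with ts that show thesis unfolding parts_def by blast
      qed
      then have "sorted_wrt (\<lambda>x y. (\<exists>e \<in> set x. \<exists>e' \<in> set y. dependent e e') \<longrightarrow>
          (tag x, tag y) \<in> id_order (concat ts)) ts"
        using unif by (intro dependent_blocks_id_order) auto
      moreover have "id_order (concat ts) \<subseteq> id_order \<tau>"
        using id_order_infix[of "concat ts" "concat xs" "concat ys"] by (simp add: concat[symmetric] bs_ts)
      ultimately have "sorted_wrt (\<lambda>x y. (tag x = a \<longrightarrow> tag y = a) \<and>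
          ((\<exists>e \<in> set x. \<exists>e' \<in> set y. dependent e e') \<longrightarrow> (tag x, tag y) \<in> id_order \<tau>)) ts"
        unfolding sorted_wrt_iff_nth_less by blast
      then show ?thesis
      proof (rule sorted_wrt_mono_rel[rotated], unfold consistent_def, intro impI ballI notI)
        fix x y e e'
        assume xy: "x \<in> set ts" "y \<in> set ts" and less: "f (tag y) < f (tag x)"
          and e: "e \<in> set x" "e' \<in> set y" "dependent e e'"
          and *: "(tag x = a \<longrightarrow> tag y = a) \<and>
            ((\<exists>e \<in> set x. \<exists>e' \<in> set y. dependent e e') \<longrightarrow> (tag x, tag y) \<in> id_order \<tau>)"
        then have "(tag x, tag y) \<in> id_order \<tau>" by blast
        \<comment> \<open>If \<open>tag x\<close> is \<open>a\<close>, so is \<open>tag y\<close>,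
          and \<open>less\<close> compares \<open>f a\<close> with itself; otherwise
          \<open>f_mono\<close> contradicts \<open>less\<close>.\<close>
        then show False using f_mono[of "tag x" "tag y"] less * by (cases "tag x = a") auto
      qed
    qed
    have "sorted_wrt (program_ordered f) (us @ [b])"
      using consistent[of "us @ [b]"]
    proof (rule sorted_wrt_mono_rel[rotated])
      fix x y
      assume "x \<in> set (us @ [b])" "y \<in> set (us @ [b])" and "consistent f x y"
      then have tags: "\<forall>e \<in> set x. snd e = tag x" "\<forall>e \<in> set y. snd e = tag y"
        using unif by (auto simp: split)
      show "program_ordered f x y"
        unfolding program_ordered_def
      proof (intro ballI impI, rule ccontr)
        fix e e'
        assume e: "e \<in> set x" "e' \<in> set y" "\<not> pops e" "\<not> pops e'" "rank_of e = rank_of e'"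
          and less: "\<not> f (snd e) \<le> f (snd e')"
        \<comment> \<open>The identifiers are distinct by \<open>less\<close>, and two program
          events of one rank are then dependent.\<close>
        then have "dependent e e'" by (cases "(e, e')" rule: dependent.cases) (auto simp: dependent.simps)
        with \<open>consistent f x y\<close> e less tags show False by (auto simp: consistent_def)
      qed
    qed (simp add: parts_def)
    moreover have pop_last: "program_ordered f x y" if "y \<in> set ws" for x y
      using that ws unfolding program_ordered_def by blast
    then have "sorted_wrt (program_ordered f) ws"
      unfolding sorted_wrt_iff_nth_less using nth_mem by blast
    ultimately have program: "sorted_wrt (program_ordered f) bs"
      using pop_last by (auto simp: split sorted_wrt_append)
    define srt where "srt = sort_key (\<lambda>b. f (tag b))"
    have "arrangement P N f (id_order \<tau>) s ([] @ (us @ [b]) @ w1 @ w2 @ w3)"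
      using bs program concat by (simp add: arrangement_def split w)
    \<comment> \<open>Each sorted part joins the prefix; the parts still to be sorted are untouched
      and stay consistent.\<close>
    from arrangement_sort[OF this consistent, folded srt_def]
    have "arrangement P N f (id_order \<tau>) s (srt (us @ [b]) @ w1 @ w2 @ w3)" by (simp add: parts_def)
    from arrangement_sort[OF this consistent, folded srt_def]
    have "arrangement P N f (id_order \<tau>) s ((srt (us @ [b]) @ srt w1) @ w2 @ w3)" by (simp add: parts_def)
    from arrangement_sort[OF this consistent, folded srt_def]
    have "arrangement P N f (id_order \<tau>) s ((srt (us @ [b]) @ srt w1 @ srt w2) @ w3 @ [])"
      by (simp add: parts_def)
    from arrangement_sort[OF this consistent, folded srt_def]
    have arr: "arrangement P N f (id_order \<tau>) s (srt (us @ [b]) @ srt w1 @ srt w2 @ srt w3)"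
      by (simp add: parts_def)
    define \<rho> where "\<rho> = concat (srt (us @ [b])) @ concat (srt w1) @ concat (srt w2) @ concat (srt w3)"
    have "\<rho> \<in> computations P N"
      using arr empty unfolding computations_iff_blocks arrangement_def \<rho>_def by fastforce
    moreover have "violating \<rho>"
      using arr \<tau>(2) by (simp add: violating_iff arrangement_def \<rho>_def)
    moreover have "normal_form \<rho>"
      unfolding \<rho>_def
    proof (rule normal_formI)
      have "set \<rho> = set \<tau>" unfolding \<rho>_def srt_def concat[symmetric] by (auto simp: split w)
      then show "inj_on f (snd ` set (concat (srt (us @ [b])) @ concat (srt w1) @ concat (srt w2) @
          concat (srt w3)))" using inj by (simp add: \<rho>_def)
      have "sorted (map (\<lambda>e. f (snd e)) (concat (srt ts)))" if "ts \<in> parts" for ts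
      proof (rule sorted_concat)
        have "set ts \<subseteq> set bs" using that by (auto simp: parts_def split w)
        then show "\<forall>b \<in> set (srt ts). \<forall>e \<in> set b. snd e = tag b"
          using unif unfolding srt_def set_sort by blast
        show "sorted (map (\<lambda>b. f (tag b)) (srt ts))" by (simp add: srt_def)
      qed
      then show "\<forall>t \<in> {concat (srt (us @ [b])), concat (srt w1), concat (srt w2), concat (srt w3)}.
          sorted (map (\<lambda>e. f (snd e)) t)" by (simp add: parts_def)
      show "\<forall>e \<in> set (concat (srt w1) @ concat (srt w2) @ concat (srt w3)). pops e"
        using ws by (auto simp: srt_def w)
    qed
    ultimately show ?thesis by blast
  qed
  then show "\<not> (\<exists>\<tau> \<in> computations P N. normal_form \<tau> \<and> violating \<tau>) \<Longrightarrow> robust P N" by blast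
qed

end
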